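(* Let $z$ be transcendental over $\mathbf{Q}$, put $t=\frac{23550-z^2}{2z}$ and $u=t^2$, and let $E$ be the elliptic curve over $\mathbf{Q}(z)$ given by $$y^2 = x^3 + (-432u^4 - 4435200u^3 + 38353513056u^2 - 18899197014000u - 340079781902569707)x + 3456u^6 + 53222400u^5 - 870054636672u^4 + 5893342291009600u^3 - 18532375351306853196u^2 + 7556017995191414902800u + 76302327326969661771531494.$$ Let $Q=(X(u),Y(u))\in E(\mathbf{Q}(\sqrt{-3},z))$ where $$X(u) = 12u^2 + (129032 + 27432\sqrt{-3})u - 168316272\sqrt{-3} - 757109813,$$ $$Y(u) = (164592 + 404592\sqrt{-3})u^2 + (1518893856 - 3588498678\sqrt{-3})u - 15516067218048 + 7021689895536\sqrt{-3}.$$ Then $nQ\notin E(\mathbf{Q}(z))$ for every integer $n\ge 1$. Consequently $Q$ together with Nagao's 13 independent points in $E(\mathbf{Q}(z))$ generates a subgroup of $E(\mathbf{Q}(\sqrt{-3},z))$ of rank $14$.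
   Context: The curve $E$ is (a Weierstrass model of) Nagao's elliptic curve, which over $\mathbf{Q}(t)$ is the genus-one curve $y^2 = (330112972800 + 14017536t^2)x^4 + (-4205260800t^2 - 99527168931840)x^3 + (10445363957523456 + 617005209600t^2 - 28035072t^4)x^2 + (-443009190070886400 - 46063725926400t^2 + 4205260800t^4)x + 6473450277365760000 + 1388825681338368t^2 - 247954636800t^4 + 14017536t^6$ with zero point $(t,\,2544297600 - 87059232t + 836160t^2)$; Nagao showed that $E(\mathbf{Q}(z))$ contains 13 independent points (for $t=\frac{23550-z^2}{2z}$ the points at infinity of this quartic model become rational). *)

theory Defs
  imports
    "HOL-Computational_Algebra.Polynomial"
    "HOL-Library.Extended_Nat"
    "HOL-Algebra.Elementary_Groups"
    "HOL-Algebra.Generated_Fields"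
    "HOL-Algebra.Algebraic_Closure_Type"
begin

text \<open>
  All fields live inside one ambient field \<open>'a\<close> of characteristic \<open>0\<close>, so the field generated
  by a set \<open>S\<close> automatically contains the prime field: this is \<open>\<rat>(S)\<close>.
\<close>

definition rat_adjoin :: "'a::field_char_0 set \<Rightarrow> 'a set" where
  "rat_adjoin S = generate_field ring_of_type_algebra S"

datatype 'a ec_point = Infinity | Affine 'a 'a

text \<open>The chord-tangent law on \<open>y\<^sup>2 = x\<^sup>3 + a x + b\<close> (the formulas do not involve \<open>b\<close>).\<close>

fun ec_add :: "'a::field \<Rightarrow> 'a ec_point \<Rightarrow> 'a ec_point \<Rightarrow> 'a ec_point" where
  "ec_add a Infinity P = P"
| "ec_add a P Infinity = P"
| "ec_add a (Affine x1 y1) (Affine x2 y2) =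
     (if x1 = x2 \<and> y1 = - y2 then Infinity
      else let l = (if x1 = x2 then (3 * x1\<^sup>2 + a) / (2 * y1) else (y2 - y1) / (x2 - x1));
               x3 = l\<^sup>2 - x1 - x2
           in Affine x3 (l * (x1 - x3) - y1))"

definition elliptic_curve :: "'a::field_char_0 set \<Rightarrow> 'a \<Rightarrow> 'a \<Rightarrow> bool" where
  "elliptic_curve K a b \<longleftrightarrow> a \<in> K \<and> b \<in> K \<and> 4 * a ^ 3 + 27 * b\<^sup>2 \<noteq> 0"

text \<open>The group \<open>E(K)\<close> of \<open>K\<close>-rational points of \<open>y\<^sup>2 = x\<^sup>3 + a x + b\<close>, written multiplicatively.\<close>

definition ec_group :: "'a::field_char_0 \<Rightarrow> 'a \<Rightarrow> 'a set \<Rightarrow> 'a ec_point monoid" where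
  "ec_group a b K =
     \<lparr>carrier = insert Infinity {Affine x y | x y. x \<in> K \<and> y \<in> K \<and> y\<^sup>2 = x ^ 3 + a * x + b},
      monoid.mult = ec_add a,
      monoid.one = Infinity\<rparr>"

definition int_independent :: "('g, 'm) monoid_scheme \<Rightarrow> 'g set \<Rightarrow> bool" where
  "int_independent G S \<longleftrightarrow> S \<subseteq> carrier G \<and>
     (\<forall>T (c :: 'g \<Rightarrow> int). finite T \<and> T \<subseteq> S \<and> (\<Otimes>\<^bsub>G\<^esub>g\<in>T. g [^]\<^bsub>G\<^esub> c g) = \<one>\<^bsub>G\<^esub>
        \<longrightarrow> (\<forall>g\<in>T. c g = 0))"

definition ab_rank :: "('g, 'm) monoid_scheme \<Rightarrow> enat" where
  "ab_rank G = (SUP S \<in> {S. finite S \<and> int_independent G S}. enat (card S))"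

definition nagao_a :: "'a::field_char_0 \<Rightarrow> 'a" where
  "nagao_a u = - 432 * u ^ 4 - 4435200 * u ^ 3 + 38353513056 * u\<^sup>2
     - 18899197014000 * u - 340079781902569707"

definition nagao_b :: "'a::field_char_0 \<Rightarrow> 'a" where
  "nagao_b u = 3456 * u ^ 6 + 53222400 * u ^ 5 - 870054636672 * u ^ 4
     + 5893342291009600 * u ^ 3 - 18532375351306853196 * u\<^sup>2
     + 7556017995191414902800 * u + 76302327326969661771531494"

text \<open>In the following two definitions, \<open>s\<close> is a square root of \<open>-3\<close>.\<close>

definition Q_x :: "'a::field_char_0 \<Rightarrow> 'a \<Rightarrow> 'a" where
  "Q_x s u = 12 * u\<^sup>2 + (129032 + 27432 * s) * u - 168316272 * s - 757109813"

definition Q_y :: "'a::field_char_0 \<Rightarrow> 'a \<Rightarrow> 'a" where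
  "Q_y s u = (164592 + 404592 * s) * u\<^sup>2 + (1518893856 - 3588498678 * s) * u
     - 15516067218048 + 7021689895536 * s"

end

theory Submission
  imports Defs
begin

text \<open>
  Let \<open>\<sigma>\<close> be the conjugation of \<open>L = K(s)\<close> over \<open>K\<close>. If \<open>n Q\<close> were \<open>K\<close>-rational, then
  \<open>n Q = n \<sigma>(Q)\<close>, so \<open>R = Q - \<sigma>(Q)\<close> would be torsion. Scale the curve at the place \<open>u = \<infinity>\<close> by
  \<open>x = u\<^sup>2 x'\<close>, \<open>y = u\<^sup>3 y'\<close>. It reduces to a nodal cubic, where \<open>R\<close> becomes a primitive cube
  root of unity of the multiplicative group, so \<open>3 R\<close> reduces to the point at infinity. Since the residue
  field has characteristic \<open>0\<close>, the kernel of reduction is torsion free: to leading order in the local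
  parameter \<open>1 / u\<close>, the points \<open>3 n R\<close> are \<open>(1 / (n c)\<^sup>2, 1 / (n c)\<^sup>3)\<close> with \<open>c \<noteq> 0\<close>.
  Hence \<open>R\<close> is not torsion, no multiple of \<open>Q\<close> is \<open>K\<close>-rational, and \<open>Q\<close> is independent of
  every independent set in \<open>E(K)\<close>.
\<close>

section \<open>The group law\<close>

text \<open>At u = \<infinity> the scaled equation becomes y'^2 = x'^3 - 432 x' + 3456 = (x' - 12)^2
  (x' + 24). Since \<open>Q_x\<close> has leading term 12 u^2 while \<open>Q_y\<close> has only
  degree 2, both Q and its conjugate reduce to the node (12, 0) and cannot be followed in the
  multiplicative group themselves; their difference R reduces to the smooth point (-36, -96 s). The
  reductions of R and 2 R share their abscissa, so the leading terms of x(2 R) - x(R) cancel and the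
  next coefficient, 1326000, has to be computed. That it is nonzero makes 3 R vanish to order
  exactly one at the place, which gives the constant c. Neither a reduction map nor a formal group
  is constructed: only limits of suitably scaled coordinates at 1 / u = 0 are tracked, as a relation
  between elements of the ambient field and their values. Conjugation is treated as a relation in
  the same way.\<close>

text \<open>
  Associativity is not checked by expanding the addition formulas. A chord or tangent is encoded by its
  slope through two polynomial equations which treat both cases alike. For \<open>P1, P2, P3\<close> with slopes
  \<open>l\<close> of \<open>P1, P2\<close> and \<open>m\<close> of \<open>P2, P3\<close>, the remaining two slopes are \<open>k - l\<close> and \<open>k - m\<close>.
\<close>

definition ec_on :: "'a::field_char_0 \<Rightarrow> 'a \<Rightarrow> 'a ec_point set" where
  "ec_on a b = insert Infinity {Affine x y | x y. y\<^sup>2 = x ^ 3 + a * x + b}"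

fun ec_opp :: "'a::field_char_0 ec_point \<Rightarrow> 'a ec_point" where
  "ec_opp Infinity = Infinity"
| "ec_opp (Affine x y) = Affine x (- y)"

lemma Infinity_on [simp]: "Infinity \<in> ec_on a b"
  by (simp add: ec_on_def)

lemma Affine_on [simp]: "Affine x y \<in> ec_on a b \<longleftrightarrow> y\<^sup>2 = x ^ 3 + a * x + b"
  by (simp add: ec_on_def)

lemma ec_opp_on [simp]: "ec_opp P \<in> ec_on a b \<longleftrightarrow> P \<in> ec_on a b"
  by (cases P) simp_all

lemma ec_opp_opp [simp]: "ec_opp (ec_opp P) = P"
  by (cases P) simp_all

lemma ec_add_Infinity [simp]: "ec_add a P Infinity = P"
  by (cases P) simp_all

lemma ec_add_opp_left [simp]: "ec_add a (ec_opp P) P = Infinity"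
  by (cases P) simp_all

lemma ec_add_opp_right [simp]: "ec_add a P (ec_opp P) = Infinity"
  by (cases P) simp_all

text \<open>On the line y = y1 + l (x - x1) the polynomial x^3 + a x + b - y^2 should have the roots
  x1, x2 and x3 = l^2 - x1 - x2. The second equation says that its derivative at x1 is (x1 - x2) (x1
  - x3). For x1 = x2 this is the tangent condition; otherwise it is what the two curve equations
  give once b is eliminated.\<close>

definition ec_slope :: "'a::field_char_0 \<Rightarrow> 'a \<Rightarrow> 'a \<Rightarrow> 'a \<Rightarrow> 'a \<Rightarrow> 'a \<Rightarrow> bool" where
  "ec_slope a x1 y1 x2 y2 l \<longleftrightarrow> l * (x2 - x1) = y2 - y1 \<and>
     3 * x1\<^sup>2 + a - 2 * l * y1 = (x1 - x2) * (2 * x1 + x2 - l\<^sup>2)"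

lemma ec_slope_sym:
  assumes "ec_slope a x1 y1 x2 y2 l" shows "ec_slope a x2 y2 x1 y1 l"
proof -
  have y2: "y2 = y1 + l * (x2 - x1)" using assms by (simp add: ec_slope_def)
  have "a = 2 * l * y1 - 3 * x1\<^sup>2 + (x1 - x2) * (2 * x1 + x2 - l\<^sup>2)"
    using assms by (simp add: ec_slope_def algebra_simps)
  then show ?thesis unfolding ec_slope_def y2 by (simp add: power2_eq_square algebra_simps)
qed

lemma ec_add_slope:
  assumes "ec_slope a x1 y1 x2 y2 l" "\<not> (x1 = x2 \<and> y1 = - y2)"
  shows "ec_add a (Affine x1 y1) (Affine x2 y2) =
     Affine (l\<^sup>2 - x1 - x2) (l * (x1 - (l\<^sup>2 - x1 - x2)) - y1)"
proof (cases "x1 = x2")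
  case True
  then have "y1 = y2" "2 * l * y1 = 3 * x1\<^sup>2 + a" using assms by (auto simp: ec_slope_def)
  moreover from this have "y1 \<noteq> 0" using assms True by auto
  ultimately have "l = (3 * x1\<^sup>2 + a) / (2 * y1)" by (simp add: field_simps)
  then show ?thesis using True assms(2) by (simp add: Let_def)
next
  case False
  then have "l = (y2 - y1) / (x2 - x1)" using assms(1) by (simp add: ec_slope_def field_simps)
  then show ?thesis using False by (simp add: Let_def)
qed

lemma ec_slope_exists:
  assumes "Affine x1 y1 \<in> ec_on a b" "Affine x2 y2 \<in> ec_on a b" "\<not> (x1 = x2 \<and> y1 = - y2)"
  obtains l where "ec_slope a x1 y1 x2 y2 l"
proof (cases "x1 = x2")
  case True
  then have "y1\<^sup>2 = y2\<^sup>2" using assms by simp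
  then have y: "y1 = y2" using assms True by (auto simp: power2_eq_iff)
  then have "y1 \<noteq> 0" using assms True by auto
  then show ?thesis using True y
    by (intro that[of "(3 * x1\<^sup>2 + a) / (2 * y1)"]) (simp add: ec_slope_def)
next
  case False
  define l where "l = (y2 - y1) / (x2 - x1)"
  have l: "l * (x2 - x1) = y2 - y1" using False by (simp add: l_def)
  have y2: "y2 = y1 + l * (x2 - x1)" using l by simp
  \<comment> \<open>Multiplied by \<open>x2 - x1\<close>, the second slope equation is the
    difference of the two curve equations, in which \<open>b\<close> cancels.\<close>
  have "(x2 - x1) * (3 * x1\<^sup>2 + a - 2 * l * y1 - (x1 - x2) * (2 * x1 + x2 - l\<^sup>2)) = 0"
  proof -
    have "(x2 - x1) * (3 * x1\<^sup>2 + a - 2 * l * y1 - (x1 - x2) * (2 * x1 + x2 - l\<^sup>2)) =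
      (y1\<^sup>2 - (x1 ^ 3 + a * x1 + b)) - (y2\<^sup>2 - (x2 ^ 3 + a * x2 + b))"
      unfolding y2 by (simp add: power2_eq_square power3_eq_cube algebra_simps)
    then show ?thesis using assms(1,2) by simp
  qed
  then show ?thesis using False l by (intro that[of l]) (simp add: ec_slope_def)
qed

text \<open>The slope equation expresses \<open>a\<close>, and the first point then expresses
  \<open>b\<close>; what remains is a polynomial identity in \<open>x1\<close>, \<open>y1\<close>,
  \<open>x2\<close> and \<open>l\<close>.\<close>

lemma ec_slope_third_on:
  assumes "ec_slope a x1 y1 x2 y2 l" "Affine x1 y1 \<in> ec_on a b"
  shows "Affine (l\<^sup>2 - x1 - x2) (l * (x1 - (l\<^sup>2 - x1 - x2)) - y1) \<in> ec_on a b"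
proof -
  have a: "a = 2 * l * y1 - 3 * x1\<^sup>2 + (x1 - x2) * (2 * x1 + x2 - l\<^sup>2)"
    using assms by (simp add: ec_slope_def algebra_simps)
  have b: "b = y1\<^sup>2 - x1 ^ 3 - a * x1" using assms by simp
  show ?thesis unfolding Affine_on b a
    by (simp add: power2_eq_square power3_eq_cube algebra_simps)
qed

lemma ec_add_on:
  assumes "P \<in> ec_on a b" "Q \<in> ec_on a b"
  shows "ec_add a P Q \<in> ec_on a b"
proof (cases P; cases Q)
  fix x1 y1 x2 y2 assume P: "P = Affine x1 y1" and Q: "Q = Affine x2 y2"
  show ?thesis
  proof (cases "x1 = x2 \<and> y1 = - y2")
    case False
    then obtain l where l: "ec_slope a x1 y1 x2 y2 l"
      using assms ec_slope_exists unfolding P Q by blast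
    show ?thesis using ec_slope_third_on[OF l] assms(1) ec_add_slope[OF l False] by (simp add: P Q)
  qed (simp add: P Q)
qed (use assms in simp_all)

lemma ec_add_commute:
  assumes "P \<in> ec_on a b" "Q \<in> ec_on a b"
  shows "ec_add a P Q = ec_add a Q P"
proof (cases P; cases Q)
  fix x1 y1 x2 y2 assume P: "P = Affine x1 y1" and Q: "Q = Affine x2 y2"
  show ?thesis
  proof (cases "x1 = x2 \<and> y1 = - y2")
    case False
    then obtain l where l: "ec_slope a x1 y1 x2 y2 l"
      using assms ec_slope_exists unfolding P Q by blast
    have "\<not> (x2 = x1 \<and> y2 = - y1)" using False by auto
    note * = ec_add_slope[OF l False] ec_add_slope[OF ec_slope_sym[OF l] this]
    have y2: "y2 = y1 + l * (x2 - x1)" using l by (simp add: ec_slope_def)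
    show ?thesis unfolding P Q * unfolding y2 by (simp add: algebra_simps)
  qed (simp add: P Q)
qed simp_all

lemma ec_opp_add:
  "ec_opp (ec_add a P Q) = ec_add a (ec_opp P) (ec_opp Q)"
proof (cases P; cases Q)
  fix x1 y1 x2 y2 assume P: "P = Affine x1 y1" and Q: "Q = Affine x2 y2"
  have *: "- y1 = y2 \<longleftrightarrow> y1 = - y2" by auto
  have "(- y2 + y1) / (x2 - x1) = - ((y2 - y1) / (x2 - x1))"
    by (simp add: divide_simps)
  then show ?thesis by (simp add: P Q Let_def *)
qed simp_all

section \<open>Cancellation and associativity on a nonsingular cubic\<close>

locale nonsingular_cubic =
  fixes a b :: "'a::field_char_0"
  assumes nonsingular: "4 * a ^ 3 + 27 * b\<^sup>2 \<noteq> 0"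
begin

text \<open>The line through \<open>P\<close> and \<open>Q\<close>, reflected, is the line through \<open>- P\<close> and \<open>P + Q\<close>.\<close>

lemma ec_add_cancel:
  assumes "P \<in> ec_on a b" "Q \<in> ec_on a b"
  shows "ec_add a (ec_opp P) (ec_add a P Q) = Q"
proof (cases P; cases Q)
  fix x1 y1 x2 y2 assume P: "P = Affine x1 y1" and Q: "Q = Affine x2 y2"
  show ?thesis
  proof (cases "x1 = x2 \<and> y1 = - y2")
    case False
    then obtain l where l: "ec_slope a x1 y1 x2 y2 l"
      using assms ec_slope_exists unfolding P Q by blast
    define x3 y3 where "x3 = l\<^sup>2 - x1 - x2" and "y3 = l * (x1 - x3) - y1"
    have PQ: "ec_add a P Q = Affine x3 y3"
      using ec_add_slope[OF l False] by (simp add: P Q x3_def y3_def)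
    have sl: "ec_slope a x1 (- y1) x3 y3 (- l)"
      using l unfolding ec_slope_def x3_def y3_def by (simp add: power2_eq_square algebra_simps)
    \<comment> \<open>If P + Q were P with Q affine, then \<open>y1\<close> and the derivative
      \<open>3 * x1^2 + a\<close> would both vanish, and P would be a singular point. The
      discriminant excludes this.\<close>
    have "\<not> (x1 = x3 \<and> - y1 = - y3)"
    proof
      assume *: "x1 = x3 \<and> - y1 = - y3"
      then have x3: "l\<^sup>2 - x1 - x2 = x1" by (simp add: x3_def)
      have y: "y1 = 0" using * by (auto simp: y3_def)
      have "3 * x1\<^sup>2 + a = (x1 - x2) * (x1 - (l\<^sup>2 - x1 - x2))"
        using l y by (simp add: ec_slope_def algebra_simps)
      then have a: "a = - 3 * x1\<^sup>2" unfolding x3 by (simp add: eq_neg_iff_add_eq_0 add.commute)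
      have "y1\<^sup>2 = x1 ^ 3 + a * x1 + b" using assms(1) by (simp add: P)
      then have b: "b = 2 * x1 ^ 3"
        unfolding a y by (simp add: power2_eq_square power3_eq_cube algebra_simps eq_neg_iff_add_eq_0)
      have "4 * a ^ 3 + 27 * b\<^sup>2 = 0"
        unfolding a b by (simp add: power_mult_distrib flip: power_mult)
      then show False using nonsingular by simp
    qed
    note add = ec_add_slope[OF sl this]
    have y2: "y2 = y1 + l * (x2 - x1)" using l by (simp add: ec_slope_def)
    have x2: "(- l)\<^sup>2 - x1 - x3 = x2" by (simp add: x3_def)
    have "- l * (x1 - x2) - - y1 = y2" unfolding y2 by (simp add: algebra_simps)
    then show ?thesis unfolding PQ unfolding P Q ec_opp.simps add x2 by simp
  qed (simp add: P Q)
qed (use assms in simp_all)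

text \<open>Both lines pass through \<open>(x2, y2)\<close>, so each slope equation expresses
  \<open>a\<close> there. Equating the two expressions and dividing by \<open>l - m\<close> yields
  \<open>2 * y2\<close> as in fact \<open>Y\<close>, from which both equations for the slope
  \<open>k - l\<close> follow. No division by \<open>x3 - x4\<close> occurs, so chord and tangent
  are covered together.\<close>

lemma ec_slope_sum:
  assumes l: "ec_slope a x1 y1 x2 y2 l" and m: "ec_slope a x2 y2 x3 y3 m"
    and "l \<noteq> m" and k: "k * (l - m) = x1 - x3"
  defines "x4 \<equiv> l\<^sup>2 - x1 - x2"
  defines "y4 \<equiv> l * (x1 - x4) - y1"
  shows "ec_slope a x4 y4 x3 y3 (k - l)"
proof -
  have x1: "x1 = x3 + k * (l - m)" using k by simp
  have y1: "y1 = y2 + l * (x1 - x2)" and y3: "y3 = y2 + m * (x3 - x2)"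
    using l m by (simp_all add: ec_slope_def algebra_simps)
  have A1: "a = 2 * l * y2 - 3 * x2\<^sup>2 + (x2 - x1) * (2 * x2 + x1 - l\<^sup>2)"
    using ec_slope_sym[OF l] by (simp add: ec_slope_def algebra_simps)
  have A2: "a = 2 * m * y2 - 3 * x2\<^sup>2 + (x2 - x3) * (2 * x2 + x3 - m\<^sup>2)"
    using m by (simp add: ec_slope_def algebra_simps)
  have "(l - m) * (2 * y2) = (x2 - x3) * (2 * x2 + x3 - m\<^sup>2) - (x2 - x1) * (2 * x2 + x1 - l\<^sup>2)"
    using A1 A2 by (simp add: algebra_simps)
  also have "\<dots> = (l - m) * ((x2 - x3) * (l + m) + k * (x3 - x4))"
    unfolding x1 x4_def by (simp add: power2_eq_square algebra_simps)
  finally have Y: "2 * y2 = (x2 - x3) * (l + m) + k * (x3 - x4)"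
    using \<open>l \<noteq> m\<close> by simp
  have y4: "y4 = l * (x2 - x4) - y2"
    unfolding y4_def y1 by (simp add: algebra_simps)
  have "y3 - y4 = 2 * y2 - m * (x2 - x3) - l * (x2 - x4)"
    unfolding y3 y4 by (simp add: algebra_simps)
  also have "\<dots> = (k - l) * (x3 - x4)" unfolding Y by (simp add: algebra_simps)
  finally have 1: "(k - l) * (x3 - x4) = y3 - y4" ..
  have l2: "l\<^sup>2 = x1 + x2 + x4" by (simp add: x4_def)
  \<comment> \<open>The derivative condition at the third intersection point
    \<open>(x4, - y4)\<close> of the first line with the cubic.\<close>
  have A4: "a = (x4 - x1) * (x4 - x2) - 3 * x4\<^sup>2 - 2 * l * y4"
  proof -
    have "a = 2 * l * y2 - 3 * x2\<^sup>2 + (x2 - x1) * (x2 - x4)"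
      unfolding A1 by (simp add: l2)
    moreover have "2 * l * y4 = 2 * l\<^sup>2 * (x2 - x4) - 2 * l * y2"
      unfolding y4 by (simp add: power2_eq_square algebra_simps)
    moreover have "(x2 - x1) * (x2 - x4) - 3 * x2\<^sup>2 =
        (x4 - x1) * (x4 - x2) - 3 * x4\<^sup>2 - 2 * (x1 + x2 + x4) * (x2 - x4)"
      by (simp add: power2_eq_square algebra_simps)
    ultimately show ?thesis unfolding l2 by simp
  qed
  have "2 * k * y4 = k * (2 * l * (x2 - x4) - 2 * y2)"
    unfolding y4 by (simp add: algebra_simps)
  also have "\<dots> = 2 * k * l * (x3 - x4) + (x2 - x3) * (k * (l - m)) - k\<^sup>2 * (x3 - x4)"
    unfolding Y by (simp add: power2_eq_square algebra_simps)
  finally have "2 * k * y4 = 2 * k * l * (x3 - x4) + (x2 - x3) * (x1 - x3) - k\<^sup>2 * (x3 - x4)"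
    unfolding k .
  moreover have "3 * x4\<^sup>2 + a - 2 * (k - l) * y4 = (x4 - x1) * (x4 - x2) - 2 * k * y4"
    unfolding A4 by (simp add: algebra_simps)
  moreover have "(k - l)\<^sup>2 = k\<^sup>2 - 2 * k * l + (x1 + x2 + x4)"
    unfolding l2[symmetric] by (simp add: power2_eq_square algebra_simps)
  ultimately have "3 * x4\<^sup>2 + a - 2 * (k - l) * y4 = (x4 - x3) * (2 * x4 + x3 - (k - l)\<^sup>2)"
    by (simp add: power2_eq_square algebra_simps)
  with 1 show ?thesis by (simp add: ec_slope_def)
qed

text \<open>The degenerate cases follow from commutativity and cancellation. In the generic case
  \<open>k = (x1 - x3) / (l - m)\<close> is unchanged when P and R are exchanged together with l and
  m, so \<open>ec_slope_sum\<close> serves both bracketings, and both results have the abscissa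
  \<open>x6\<close>, which is symmetric in l and m.\<close>

lemma ec_add_assoc:
  assumes on: "P \<in> ec_on a b" "Q \<in> ec_on a b" "R \<in> ec_on a b"
  shows "ec_add a (ec_add a P Q) R = ec_add a P (ec_add a Q R)"
proof -
  note comm = ec_add_commute[of _ a b]
  consider "P = Infinity" | "Q = Infinity" | "R = Infinity" | "P = R"
    | "P = ec_opp Q" | "Q = ec_opp R" | "ec_add a P Q = ec_opp R" | "P = ec_opp (ec_add a Q R)"
    | (generic) "P \<noteq> Infinity" "Q \<noteq> Infinity" "R \<noteq> Infinity" "P \<noteq> R"
      "P \<noteq> ec_opp Q" "Q \<noteq> ec_opp R" "ec_add a P Q \<noteq> ec_opp R" "P \<noteq> ec_opp (ec_add a Q R)"
    by blast
  then show ?thesis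
  proof cases
    case 4
    then show ?thesis
      using ec_add_commute[OF ec_add_on[OF on(1,2)] on(1)] ec_add_commute[OF on(1,2)] by metis
  next
    case 5
    then show ?thesis using on ec_add_cancel[of Q R] by simp
  next
    case 6
    then have opp: "ec_opp Q = R" by simp
    have "ec_add a (ec_add a P Q) R = ec_add a R (ec_add a Q P)"
      using comm[OF ec_add_on[OF on(1,2)] on(3)] comm[OF on(1,2)] by metis
    also have "\<dots> = P" using ec_add_cancel[OF on(2,1)] by (simp only: opp)
    finally show ?thesis using 6 by simp
  next
    case 7
    then have R: "R = ec_add a (ec_opp P) (ec_opp Q)" by (simp flip: ec_opp_add)
    have "ec_add a Q R = ec_opp P"
      using ec_add_cancel[of "ec_opp Q" "ec_opp P"] on comm[of "ec_opp P" "ec_opp Q"]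
      unfolding R by simp
    with 7 show ?thesis by simp
  next
    case 8
    then have P: "P = ec_add a (ec_opp Q) (ec_opp R)" by (simp flip: ec_opp_add)
    have "ec_add a P Q = ec_opp R"
      using ec_add_cancel[of "ec_opp Q" "ec_opp R"] on comm[of P Q] unfolding P by simp
    with 8 show ?thesis by simp
  next
    case generic
    from generic(1-3) obtain x1 y1 x2 y2 x3 y3 where P: "P = Affine x1 y1" and Q: "Q = Affine x2 y2"
      and R: "R = Affine x3 y3" by (metis ec_point.exhaust)
    have PQ: "\<not> (x1 = x2 \<and> y1 = - y2)" and QR: "\<not> (x2 = x3 \<and> y2 = - y3)"
      using generic(5,6) by (simp_all add: P Q R)
    obtain l where l: "ec_slope a x1 y1 x2 y2 l"
      using on PQ ec_slope_exists unfolding P Q by blast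
    obtain m where m: "ec_slope a x2 y2 x3 y3 m"
      using on QR ec_slope_exists unfolding Q R by blast
    define x4 y4 where "x4 = l\<^sup>2 - x1 - x2" and "y4 = l * (x1 - x4) - y1"
    define x5 y5 where "x5 = m\<^sup>2 - x3 - x2" and "y5 = m * (x3 - x5) - y3"
    have S: "ec_add a P Q = Affine x4 y4"
      unfolding P Q x4_def y4_def by (rule ec_add_slope[OF l PQ])
    have "\<not> (x3 = x2 \<and> y3 = - y2)" using QR by auto
    then have "ec_add a R Q = Affine x5 y5"
      unfolding Q R x5_def y5_def by (rule ec_add_slope[OF ec_slope_sym[OF m]])
    then have T: "ec_add a Q R = Affine x5 y5" by (rule trans[OF comm[OF on(2,3)]])
    have y1: "y1 = y2 + l * (x1 - x2)" and y3: "y3 = y2 + m * (x3 - x2)"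
      using l m by (simp_all add: ec_slope_def algebra_simps)
    \<comment> \<open>Equal slopes would put P, Q and R on one line; then \<open>x3\<close> is
      \<open>x1\<close> or \<open>x4\<close>, that is, P = R or P + Q = - R, and both are
      excluded.\<close>
    have "l \<noteq> m"
    proof
      assume "l = m"
      have "(x2 - x1) * (2 * x2 + x1 - l\<^sup>2) = (x2 - x3) * (2 * x2 + x3 - m\<^sup>2)"
        using ec_slope_sym[OF l] m \<open>l = m\<close> by (simp add: ec_slope_def)
      then have "(x1 - x3) * (x3 - x4) = 0"
        unfolding \<open>l = m\<close> x4_def by (simp add: power2_eq_square algebra_simps)
      then consider "x1 = x3" | "x3 = x4" by auto
      then show False
      proof cases
        case 1
        then show False using y1 y3 \<open>l = m\<close> generic(4) by (simp add: P R)
      next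
        case 2
        then have "y4 = - y3" unfolding y4_def y3 \<open>l = m\<close> y1 by (simp add: algebra_simps)
        then show False using generic(7) 2 unfolding S R by simp
      qed
    qed
    define k where "k = (x1 - x3) / (l - m)"
    have k: "k * (l - m) = x1 - x3" using \<open>l \<noteq> m\<close> by (simp add: k_def)
    have "k * (m - l) = - (k * (l - m))" by (simp add: algebra_simps)
    then have k': "k * (m - l) = x3 - x1" unfolding k by simp
    have s1: "ec_slope a x4 y4 x3 y3 (k - l)"
      unfolding x4_def y4_def by (rule ec_slope_sum[OF l m \<open>l \<noteq> m\<close> k])
    have s2: "ec_slope a x5 y5 x1 y1 (k - m)"
      unfolding x5_def y5_def
      by (rule ec_slope_sum[OF ec_slope_sym[OF m] ec_slope_sym[OF l] \<open>l \<noteq> m\<close>[symmetric] k'])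
    have "\<not> (x4 = x3 \<and> y4 = - y3)" "\<not> (x1 = x5 \<and> y1 = - y5)"
      using generic(7,8) unfolding S T unfolding P R by simp_all
    note add = ec_add_slope[OF s1 this(1)] ec_add_slope[OF ec_slope_sym[OF s2] this(2)]
    define x6 where "x6 = k\<^sup>2 - k * (l + m) + x2"
    have eq1: "(k - l)\<^sup>2 - x4 - x3 = x6"
    proof -
      have "(k - l)\<^sup>2 - x4 - x3 = k\<^sup>2 - k * (l + m) - k * (l - m) + x1 + x2 - x3"
        unfolding x4_def by (simp add: power2_eq_square algebra_simps)
      then show ?thesis unfolding k x6_def by simp
    qed
    have eq2: "(k - m)\<^sup>2 - x1 - x5 = x6"
    proof -
      have "(k - m)\<^sup>2 - x1 - x5 = k\<^sup>2 - k * (l + m) + k * (l - m) - x1 + x2 + x3"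
        unfolding x5_def by (simp add: power2_eq_square algebra_simps)
      then show ?thesis unfolding k x6_def by simp
    qed
    have "(k - l) * (x4 - x6) - y4 = (k - l) * (x3 - x6) - y3"
      using s1 by (simp add: ec_slope_def algebra_simps)
    also have "\<dots> = (k - m) * (x1 - x6) - y1"
    proof -
      have "((k - l) * (x3 - x6) - y3) - ((k - m) * (x1 - x6) - y1)
        = (k * (l - m) - (x1 - x3)) * (k - (l + m))"
        unfolding y1 y3 x6_def by (simp add: power2_eq_square algebra_simps)
      then show ?thesis using k by simp
    qed
    finally show ?thesis
      unfolding S T unfolding P R add eq1 eq2 by simp
  qed simp_all
qed

end

section \<open>Rank of abelian groups\<close>

lemma (in comm_group) finprod_subgroup:
  assumes "subgroup H G" "finite T" "f \<in> T \<rightarrow> H"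
  shows "finprod (G\<lparr>carrier := H\<rparr>) f T = finprod G f T"
proof -
  interpret H: comm_group "G\<lparr>carrier := H\<rparr>"
    using subgroup_imp_group[OF assms(1)] subgroup.subset[OF assms(1)]
    by (intro group.group_comm_groupI) (auto intro: m_comm)
  have "H \<subseteq> carrier G" by (rule subgroup.subset[OF assms(1)])
  then have "f \<in> T \<rightarrow> carrier G" using assms(3) by auto
  with assms(2,3) show ?thesis
    by (induction T rule: finite_induct) (simp_all add: Pi_def)
qed

lemma (in comm_group) int_independent_subgroup_iff:
  assumes H: "subgroup H G"
  shows "int_independent (G\<lparr>carrier := H\<rparr>) S \<longleftrightarrow> S \<subseteq> H \<and> int_independent G S"
proof -
  have "(\<Otimes>\<^bsub>G\<lparr>carrier := H\<rparr>\<^esub>g\<in>T. g [^]\<^bsub>G\<lparr>carrier := H\<rparr>\<^esub> c g) = (\<Otimes>g\<in>T. g [^] c g)"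
    if "S \<subseteq> H" "finite T" "T \<subseteq> S" for T and c :: "'a \<Rightarrow> int"
  proof -
    have T: "T \<subseteq> H" and HG: "H \<subseteq> carrier G"
      using that subgroup.subset[OF H] by auto
    then have pow: "g [^]\<^bsub>G\<lparr>carrier := H\<rparr>\<^esub> c g = g [^] c g" if "g \<in> T" for g
      using that int_pow_consistent[OF H, of g] by auto
    have mem: "g [^] c g \<in> H" if "g \<in> T" for g
      using that T subgroup_int_pow_closed[OF H] by auto
    have "(\<Otimes>\<^bsub>G\<lparr>carrier := H\<rparr>\<^esub>g\<in>T. g [^]\<^bsub>G\<lparr>carrier := H\<rparr>\<^esub> c g) = (\<Otimes>g\<in>T. g [^]\<^bsub>G\<lparr>carrier := H\<rparr>\<^esub> c g)"
      using mem pow by (intro finprod_subgroup[OF H \<open>finite T\<close>]) auto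
    also have "\<dots> = (\<Otimes>g\<in>T. g [^] c g)"
      using T HG by (intro finprod_cong' refl) (auto simp: pow)
    finally show ?thesis .
  qed
  then have "int_independent (G\<lparr>carrier := H\<rparr>) S \<longleftrightarrow> int_independent G S" if "S \<subseteq> H"
    using that subgroup.subset[OF H] by (simp add: int_independent_def subset_trans cong: conj_cong)
  then show ?thesis by (auto simp: int_independent_def)
qed

text \<open>In a relation that involves \<open>q\<close> all other factors lie in \<open>H\<close>,
  so \<open>q [^] c q\<close> lies there too, which forces \<open>c q = 0\<close> and leaves a
  relation within \<open>S\<close>.\<close>

lemma (in comm_group) int_independent_insert:
  assumes H: "subgroup H G" and S: "int_independent G S" "S \<subseteq> H"
    and q: "q \<in> carrier G" "\<And>n::nat. n \<ge> 1 \<Longrightarrow> q [^] n \<notin> H"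
  shows "int_independent G (insert q S)"
  unfolding int_independent_def
proof (intro conjI allI impI)
  show "insert q S \<subseteq> carrier G" using q S by (auto simp: int_independent_def)
  fix T and c :: "'a \<Rightarrow> int"
  assume T: "finite T \<and> T \<subseteq> insert q S \<and> (\<Otimes>g\<in>T. g [^] c g) = \<one>"
  have SG: "S \<subseteq> carrier G" using S by (simp add: int_independent_def)
  have *: "\<forall>g\<in>T'. c g = 0" if "finite T'" "T' \<subseteq> S" "(\<Otimes>g\<in>T'. g [^] c g) = \<one>" for T'
    using S(1) that unfolding int_independent_def by blast
  show "\<forall>g\<in>T. c g = 0"
  proof (cases "q \<in> T")
    case False
    then show ?thesis using T by (intro *) auto
  next
    case True
    define T' where "T' = T - {q}"
    have T': "finite T'" "T' \<subseteq> S" "q \<notin> T'" "T = insert q T'"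
      using T True by (auto simp: T'_def)
    define h where "h = (\<Otimes>g\<in>T'. g [^] c g)"
    have "h \<in> H"
      unfolding h_def using T'(1,2)
    proof (induction T')
      case empty
      then show ?case using subgroup.one_closed[OF H] by simp
    next
      case (insert g T')
      then have "g \<in> H" "g [^] c g \<in> H" using S(2) subgroup_int_pow_closed[OF H] by auto
      then show ?case using insert SG subgroup.m_closed[OF H]
        by (subst finprod_insert) auto
    qed
    then have hG: "h \<in> carrier G" using subgroup.subset[OF H] by auto
    have "(\<Otimes>g\<in>T. g [^] c g) = q [^] c q \<otimes> h"
      unfolding T'(4) h_def using T' SG q by (intro finprod_insert) auto
    then have "q [^] c q \<otimes> h = \<one>" using T by simp
    then have "q [^] c q = inv h" using hG q(1) inv_equality by (metis int_pow_closed inv_inv)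
    then have qc: "q [^] c q \<in> H" using \<open>h \<in> H\<close> subgroup.m_inv_closed[OF H] by simp
    \<comment> \<open>The hypothesis on \<open>q\<close> speaks of natural exponents, so the sign of
      \<open>c q\<close> is removed by passing to the inverse.\<close>
    then have "q [^] (- c q) \<in> H"
      using subgroup.m_inv_closed[OF H] q(1) by (simp add: int_pow_neg)
    with qc have "q [^] \<bar>c q\<bar> \<in> H" by (simp add: abs_if)
    then have "q [^] nat \<bar>c q\<bar> \<in> H" by (metis abs_ge_zero int_nat_eq int_pow_int)
    then have c0: "c q = 0" using q(2)[of "nat \<bar>c q\<bar>"] by linarith
    then have "h = \<one>" using \<open>q [^] c q \<otimes> h = \<one>\<close> hG by simp
    then show ?thesis using *[OF T'(1,2)] c0 T'(4) by (auto simp: h_def)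
  qed
qed

text \<open>Gaussian elimination without division, by induction on the number of equations: a row
  \<open>p\<close> with \<open>v p g \<noteq> 0\<close> clears the coordinate \<open>g\<close> from
  the other rows.\<close>

lemma ex_int_linear_dependence:
  fixes v :: "'t \<Rightarrow> 'g \<Rightarrow> int"
  assumes "finite A" "finite T" "card A < card T"
  shows "\<exists>d. (\<exists>t\<in>T. d t \<noteq> 0) \<and> (\<forall>g\<in>A. (\<Sum>t\<in>T. d t * v t g) = 0)"
  using assms
proof (induction A arbitrary: T v rule: finite_induct)
  case empty
  then have "T \<noteq> {}" by auto
  then show ?case by (intro exI[of _ "\<lambda>_. 1"]) auto
next
  case (insert g A)
  show ?case
  proof (cases "\<forall>t\<in>T. v t g = 0")
    case True
    then show ?thesis using insert.IH[of T v] insert.prems insert.hyps by auto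
  next
    case False
    then obtain p where p: "p \<in> T" "v p g \<noteq> 0" by auto
    define T' where "T' = T - {p}"
    have T': "finite T'" "T = insert p T'" "p \<notin> T'" using p insert.prems by (auto simp: T'_def)
    then have "card A < card T'" using insert by simp
    from insert.IH[OF T'(1) this, of "\<lambda>t h. v p g * v t h - v t g * v p h"] obtain d
      where d: "\<exists>t\<in>T'. d t \<noteq> 0" "\<And>h. h \<in> A \<Longrightarrow> (\<Sum>t\<in>T'. d t * (v p g * v t h - v t g * v p h)) = 0"
      by auto
    \<comment> \<open>The coefficients obtained for the reduced rows are scaled by the pivot, and
      the coefficient of \<open>p\<close> is chosen so that the coordinate \<open>g\<close>
      cancels.\<close>
    define e where "e t = (if t = p then - (\<Sum>t\<in>T'. d t * v t g) else v p g * d t)" for t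
    have e: "(\<Sum>t\<in>T. e t * v t h) = (\<Sum>t\<in>T'. d t * (v p g * v t h - v t g * v p h))" for h
    proof -
      have "(\<Sum>t\<in>T'. e t * v t h) = (\<Sum>t\<in>T'. v p g * d t * v t h)"
        using T' by (intro sum.cong) (auto simp: e_def)
      then show ?thesis using T'
        by (simp add: e_def sum_distrib_left sum_distrib_right sum_subtractf algebra_simps)
    qed
    have "(\<Sum>t\<in>T. e t * v t h) = 0" if "h \<in> insert g A" for h
      using that d(2) by (auto simp: e mult.commute)
    moreover have "\<exists>t\<in>T. e t \<noteq> 0"
      using d(1) p T' by (auto simp: e_def)
    ultimately show ?thesis by blast
  qed
qed

lemma (in comm_group) generate_finprod:
  assumes A: "finite A" "A \<subseteq> carrier G" and "x \<in> generate G A"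
  shows "\<exists>c :: 'a \<Rightarrow> int. x = (\<Otimes>g\<in>A. g [^] c g)"
  using assms(3)
proof (induction rule: generate.induct)
  case one
  show ?case using A by (intro exI[of _ "\<lambda>_. 0"]) (simp add: finprod_one_eqI)
next
  case (incl h)
  have "(\<Otimes>g\<in>A. g [^] (if g = h then 1 else 0 :: int)) = (\<Otimes>g\<in>A. if h = g then g else \<one>)"
    using A by (intro finprod_cong') auto
  also have "\<dots> = h" using A incl by (intro finprod_singleton) auto
  finally show ?case by metis
next
  case (inv h)
  have "(\<Otimes>g\<in>A. g [^] (if g = h then - 1 else 0 :: int)) = (\<Otimes>g\<in>A. if h = g then inv g else \<one>)"
    using A by (intro finprod_cong') (auto simp: int_pow_neg)
  also have "\<dots> = inv h" using A inv by (intro finprod_singleton) auto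
  finally show ?case by metis
next
  case (eng x y)
  then obtain c d :: "'a \<Rightarrow> int" where "x = (\<Otimes>g\<in>A. g [^] c g)" "y = (\<Otimes>g\<in>A. g [^] d g)" by auto
  then have "x \<otimes> y = (\<Otimes>g\<in>A. g [^] c g \<otimes> g [^] d g)"
    using A by (subst finprod_multf) auto
  also have "\<dots> = (\<Otimes>g\<in>A. g [^] (c g + d g))"
    using A by (intro finprod_cong') (auto simp: int_pow_mult)
  finally show ?case by (rule exI[of _ "\<lambda>g. c g + d g"])
qed

lemma (in comm_group) int_pow_finprod:
  assumes "finite A" "f \<in> A \<rightarrow> carrier G"
  shows "(\<Otimes>g\<in>A. f g) [^] (n::int) = (\<Otimes>g\<in>A. f g [^] n)"
  using assms by (induction A) (simp_all add: Pi_def int_pow_distrib int_pow_one)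

lemma (in comm_group) finprod_int_pow_sum:
  assumes "finite T" "x \<in> carrier G"
  shows "(\<Otimes>t\<in>T. x [^] (f t :: int)) = x [^] (\<Sum>t\<in>T. f t)"
  using assms by (induction T) (simp_all add: Pi_def int_pow_mult)

lemma (in comm_group) finprod_swap:
  assumes "finite S" "finite T" "\<And>x y. x \<in> S \<Longrightarrow> y \<in> T \<Longrightarrow> f x y \<in> carrier G"
  shows "(\<Otimes>x\<in>S. \<Otimes>y\<in>T. f x y) = (\<Otimes>y\<in>T. \<Otimes>x\<in>S. f x y)"
  using assms
proof (induction S)
  case (insert a S)
  have "(\<Otimes>x\<in>insert a S. \<Otimes>y\<in>T. f x y) = (\<Otimes>y\<in>T. f a y) \<otimes> (\<Otimes>x\<in>S. \<Otimes>y\<in>T. f x y)"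
    using insert by (intro finprod_insert) (auto intro!: finprod_closed)
  also have "\<dots> = (\<Otimes>y\<in>T. f a y \<otimes> (\<Otimes>x\<in>S. f x y))"
    using insert by (subst finprod_multf) (auto intro!: finprod_closed)
  also have "\<dots> = (\<Otimes>y\<in>T. \<Otimes>x\<in>insert a S. f x y)"
    using insert by (intro finprod_cong' refl) (auto intro!: finprod_closed)
  finally show ?case .
qed (simp add: finprod_one_eqI)

text \<open>If \<open>T\<close> were larger, the exponent vectors of its elements with respect to
  \<open>A\<close> would be more integer vectors than coordinates; a nontrivial dependence among
  them is a nontrivial relation in \<open>T\<close>.\<close>

lemma (in comm_group) card_int_independent_le:
  assumes A: "finite A" "A \<subseteq> carrier G" and T: "finite T" "T \<subseteq> generate G A" "int_independent G T"
  shows "card T \<le> card A"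
proof (rule ccontr)
  assume "\<not> card T \<le> card A"
  then have lt: "card A < card T" by simp
  have "\<forall>t\<in>T. \<exists>c :: 'a \<Rightarrow> int. t = (\<Otimes>g\<in>A. g [^] c g)"
    using generate_finprod[OF A] T by auto
  then obtain v :: "'a \<Rightarrow> 'a \<Rightarrow> int" where v: "\<And>t. t \<in> T \<Longrightarrow> t = (\<Otimes>g\<in>A. g [^] v t g)" by metis
  obtain d where d: "\<exists>t\<in>T. d t \<noteq> 0" "\<And>g. g \<in> A \<Longrightarrow> (\<Sum>t\<in>T. d t * v t g) = 0"
    using ex_int_linear_dependence[OF A(1) T(1) lt, of v] by blast
  have TG: "T \<subseteq> carrier G" using T by (simp add: int_independent_def)
  have "(\<Otimes>t\<in>T. t [^] d t) = (\<Otimes>t\<in>T. \<Otimes>g\<in>A. g [^] (d t * v t g))"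
  proof (intro finprod_cong' refl)
    fix t assume t: "t \<in> T"
    have "t [^] d t = (\<Otimes>g\<in>A. g [^] v t g) [^] d t" using v[OF t] by simp
    also have "\<dots> = (\<Otimes>g\<in>A. (g [^] v t g) [^] d t)" using A by (intro int_pow_finprod) auto
    also have "\<dots> = (\<Otimes>g\<in>A. g [^] (d t * v t g))"
      using A by (intro finprod_cong' refl) (auto simp: int_pow_pow mult.commute)
    finally show "t [^] d t = (\<Otimes>g\<in>A. g [^] (d t * v t g))" .
  qed (use A in \<open>auto intro!: finprod_closed\<close>)
  also have "\<dots> = (\<Otimes>g\<in>A. \<Otimes>t\<in>T. g [^] (d t * v t g))"
    using A T by (intro finprod_swap) auto
  also have "\<dots> = (\<Otimes>g\<in>A. g [^] (\<Sum>t\<in>T. d t * v t g))"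
    using A T by (intro finprod_cong' refl) (auto simp: finprod_int_pow_sum)
  also have "\<dots> = \<one>" using A d by (intro finprod_one_eqI) auto
  finally show False using T(1,3) d(1) unfolding int_independent_def by blast
qed

lemma (in comm_group) ab_rank_subgroup_generated:
  assumes A: "finite A" "int_independent G A"
  shows "ab_rank (subgroup_generated G A) = enat (card A)"
proof -
  have AG: "A \<subseteq> carrier G" using A by (simp add: int_independent_def)
  then have gen: "subgroup_generated G A = G\<lparr>carrier := generate G A\<rparr>"
    by (simp add: subgroup_generated_def Int_absorb1)
  have H: "subgroup (generate G A) G" by (rule generate_is_subgroup[OF AG])
  have AH: "A \<subseteq> generate G A" by (auto intro: generate.incl)
  show ?thesis
    unfolding ab_rank_def gen int_independent_subgroup_iff[OF H]
    using A AH AG card_int_independent_le[OF A(1) AG] by (intro antisym SUP_least SUP_upper2[of A]) auto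
qed

section \<open>Subfields and transcendental elements\<close>

text \<open>Division by zero gives 0, an element of every subfield, so closure under division can be
  stated for all pairs.\<close>

definition subfield_set :: "'a::field set \<Rightarrow> bool" where
  "subfield_set F \<longleftrightarrow> 1 \<in> F \<and> (\<forall>x\<in>F. \<forall>y\<in>F. x - y \<in> F \<and> x * y \<in> F \<and> x / y \<in> F)"

lemma subfield_setD:
  assumes "subfield_set F"
  shows "0 \<in> F" "1 \<in> F" "x \<in> F \<Longrightarrow> - x \<in> F" "x \<in> F \<Longrightarrow> y \<in> F \<Longrightarrow> x + y \<in> F"
    "x \<in> F \<Longrightarrow> y \<in> F \<Longrightarrow> x - y \<in> F" "x \<in> F \<Longrightarrow> y \<in> F \<Longrightarrow> x * y \<in> F"
    "x \<in> F \<Longrightarrow> y \<in> F \<Longrightarrow> x / y \<in> F" "x \<in> F \<Longrightarrow> x ^ n \<in> F" "numeral k \<in> F"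
proof -
  note F = assms[unfolded subfield_set_def]
  show one: "1 \<in> F" using F by blast
  have zero: "0 \<in> F" using F one by (metis diff_self)
  then show "0 \<in> F" .
  have minus: "- x \<in> F" if "x \<in> F" for x using F that zero by (metis diff_0)
  then show "x \<in> F \<Longrightarrow> - x \<in> F" .
  have add: "x + y \<in> F" if "x \<in> F" "y \<in> F" for x y
    using F that minus by (metis diff_minus_eq_add)
  then show "x \<in> F \<Longrightarrow> y \<in> F \<Longrightarrow> x + y \<in> F" .
  show "x \<in> F \<Longrightarrow> y \<in> F \<Longrightarrow> x - y \<in> F" "x \<in> F \<Longrightarrow> y \<in> F \<Longrightarrow> x * y \<in> F"
    "x \<in> F \<Longrightarrow> y \<in> F \<Longrightarrow> x / y \<in> F" using F by blast+
  show "x ^ n \<in> F" if "x \<in> F" using that F one by (induction n) auto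
  show "numeral k \<in> F" by (induction k) (use add one in \<open>simp_all only: numeral.simps\<close>)
qed

lemma subfield_set_sum:
  assumes "subfield_set F" "\<And>i. i \<in> I \<Longrightarrow> f i \<in> F"
  shows "sum f I \<in> F"
  using assms(2) by (induction I rule: infinite_finite_induct) (auto intro: subfield_setD[OF assms(1)])

lemma subfield_set_Rats: "subfield_set (\<rat> :: 'a::field_char_0 set)"
  by (simp add: subfield_set_def)

text \<open>Dictionary between the record operations used by \<open>generate_field\<close> and the
  type class operations.\<close>

lemma type_algebra_ops:
  fixes x y :: "'a::field"
  defines "R \<equiv> ring_of_type_algebra :: 'a ring"
  shows "\<one>\<^bsub>R\<^esub> = 1" "\<zero>\<^bsub>R\<^esub> = 0" "x \<oplus>\<^bsub>R\<^esub> y = x + y" "x \<otimes>\<^bsub>R\<^esub> y = x * y"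
    "\<ominus>\<^bsub>R\<^esub> x = - x" "x \<noteq> 0 \<Longrightarrow> inv\<^bsub>R\<^esub> x = inverse x"
proof -
  interpret R: field R unfolding R_def by (rule field_from_type_algebra)
  have ops: "carrier R = UNIV" "\<one>\<^bsub>R\<^esub> = 1" "\<zero>\<^bsub>R\<^esub> = 0"
    "x \<oplus>\<^bsub>R\<^esub> y = x + y" "x \<otimes>\<^bsub>R\<^esub> y = x * y" for x y
    by (simp_all add: R_def ring_of_type_algebra_def)
  then show "\<one>\<^bsub>R\<^esub> = 1" "\<zero>\<^bsub>R\<^esub> = 0" "x \<oplus>\<^bsub>R\<^esub> y = x + y" "x \<otimes>\<^bsub>R\<^esub> y = x * y"
    by blast+
  show "\<ominus>\<^bsub>R\<^esub> x = - x" using R.minus_equality[of "- x" x] by (simp add: ops)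
  show "inv\<^bsub>R\<^esub> x = inverse x" if "x \<noteq> 0"
    using that R.comm_inv_char[of x "inverse x"] by (simp add: ops)
qed

lemma subfield_set_rat_adjoin: "subfield_set (rat_adjoin S)"
proof -
  let ?R = "ring_of_type_algebra :: 'a ring"
  have 1: "1 \<in> rat_adjoin S" using generate_field.one[of ?R S] by (simp add: type_algebra_ops rat_adjoin_def)
  have add: "x + y \<in> rat_adjoin S" if "x \<in> rat_adjoin S" "y \<in> rat_adjoin S" for x y
    using generate_field.eng_add[of x ?R S y] that by (simp add: type_algebra_ops rat_adjoin_def)
  have mult: "x * y \<in> rat_adjoin S" if "x \<in> rat_adjoin S" "y \<in> rat_adjoin S" for x y
    using generate_field.eng_mult[of x ?R S y] that by (simp add: type_algebra_ops rat_adjoin_def)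
  have uminus: "- x \<in> rat_adjoin S" if "x \<in> rat_adjoin S" for x
    using generate_field.a_inv[of x ?R S] that by (simp add: type_algebra_ops rat_adjoin_def)
  have inv: "inverse x \<in> rat_adjoin S" if "x \<in> rat_adjoin S" "x \<noteq> 0" for x
    using generate_field.m_inv[of x ?R S] that by (simp add: type_algebra_ops rat_adjoin_def)
  have 0: "0 \<in> rat_adjoin S" using add[OF 1 uminus[OF 1]] by simp
  have "x - y \<in> rat_adjoin S" "x / y \<in> rat_adjoin S"
    if "x \<in> rat_adjoin S" "y \<in> rat_adjoin S" for x y
    using that add[of x "- y"] uminus[of y] mult[of x "inverse y"] inv[of y] 0
    by (cases "y = 0"; simp add: divide_inverse)+
  then show ?thesis using 1 mult by (simp add: subfield_set_def)
qed

lemma rat_adjoin_incl: "x \<in> S \<Longrightarrow> x \<in> rat_adjoin S"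
  by (simp add: rat_adjoin_def generate_field.incl)

lemma rat_adjoin_least:
  assumes F: "subfield_set F" and S: "S \<subseteq> F"
  shows "rat_adjoin S \<subseteq> F"
proof
  let ?R = "ring_of_type_algebra :: 'a ring"
  fix x assume "x \<in> rat_adjoin S"
  then have "x \<in> generate_field ?R S" by (simp add: rat_adjoin_def)
  then show "x \<in> F"
    by (induction rule: generate_field.induct)
      (use S in \<open>auto simp: type_algebra_ops inverse_eq_divide intro: subfield_setD[OF F]\<close>)
qed

section \<open>Polynomials and rational functions over a subfield\<close>

definition coeffs_in :: "'a::field set \<Rightarrow> 'a poly \<Rightarrow> bool" where
  "coeffs_in F p \<longleftrightarrow> (\<forall>i. coeff p i \<in> F)"

definition transcendental_over :: "'a::field set \<Rightarrow> 'a \<Rightarrow> bool" where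
  "transcendental_over F w \<longleftrightarrow> (\<forall>p. coeffs_in F p \<and> poly p w = 0 \<longrightarrow> p = 0)"

lemma coeffs_in_pCons [simp]: "coeffs_in F (pCons c p) \<longleftrightarrow> c \<in> F \<and> coeffs_in F p"
  by (auto simp: coeffs_in_def coeff_pCons split: nat.splits)

lemma coeffs_in_0: "subfield_set F \<Longrightarrow> coeffs_in F 0"
  by (simp add: coeffs_in_def subfield_setD)

lemma coeffs_in_add: "subfield_set F \<Longrightarrow> coeffs_in F p \<Longrightarrow> coeffs_in F q \<Longrightarrow> coeffs_in F (p + q)"
  by (simp add: coeffs_in_def subfield_setD)

lemma coeffs_in_diff: "subfield_set F \<Longrightarrow> coeffs_in F p \<Longrightarrow> coeffs_in F q \<Longrightarrow> coeffs_in F (p - q)"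
  by (simp add: coeffs_in_def subfield_setD)

lemma coeffs_in_smult: "subfield_set F \<Longrightarrow> c \<in> F \<Longrightarrow> coeffs_in F p \<Longrightarrow> coeffs_in F (smult c p)"
  by (simp add: coeffs_in_def subfield_setD)

lemma coeffs_in_mult: "subfield_set F \<Longrightarrow> coeffs_in F p \<Longrightarrow> coeffs_in F q \<Longrightarrow> coeffs_in F (p * q)"
  unfolding coeffs_in_def coeff_mult by (auto intro!: subfield_set_sum intro: subfield_setD)

lemma coeffs_in_power: "subfield_set F \<Longrightarrow> coeffs_in F p \<Longrightarrow> coeffs_in F (p ^ n)"
  by (induction n) (simp_all add: coeffs_in_mult one_pCons subfield_setD coeffs_in_0)

lemma coeffs_in_sum:
  assumes "subfield_set F" "\<And>i. i \<in> I \<Longrightarrow> coeffs_in F (f i)"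
  shows "coeffs_in F (sum f I)"
  using assms unfolding coeffs_in_def coeff_sum by (auto intro!: subfield_set_sum)

lemma transcendental_over_Rats: "transcendental_over \<rat> w \<longleftrightarrow> \<not> algebraic w"
  by (auto simp: transcendental_over_def algebraic_altdef coeffs_in_def)

text \<open>The field F(w), presented by fractions, so that an element comes with a numerator and a
  denominator.\<close>

definition rational_values :: "'a::field set \<Rightarrow> 'a \<Rightarrow> 'a set" where
  "rational_values F w = {poly p w / poly q w | p q. coeffs_in F p \<and> coeffs_in F q \<and> poly q w \<noteq> 0}"

lemma rational_valuesI:
  "f = poly p w / poly q w \<Longrightarrow> coeffs_in F p \<Longrightarrow> coeffs_in F q \<Longrightarrow> poly q w \<noteq> 0 \<Longrightarrow>
    f \<in> rational_values F w"
  by (auto simp: rational_values_def)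

lemma subfield_set_rational_values:
  assumes F: "subfield_set F"
  shows "subfield_set (rational_values F w)"
  unfolding subfield_set_def
proof (intro conjI ballI)
  have one: "coeffs_in F 1" by (simp add: one_pCons subfield_setD[OF F] coeffs_in_0[OF F])
  show "1 \<in> rational_values F w"
    by (rule rational_valuesI[of _ 1 _ 1]) (simp_all add: one)
  fix x y assume "x \<in> rational_values F w" "y \<in> rational_values F w"
  then obtain p q p' q' where
    x: "x = poly p w / poly q w" "coeffs_in F p" "coeffs_in F q" "poly q w \<noteq> 0" and
    y: "y = poly p' w / poly q' w" "coeffs_in F p'" "coeffs_in F q'" "poly q' w \<noteq> 0"
    unfolding rational_values_def by blast
  note cl = coeffs_in_mult[OF F] coeffs_in_diff[OF F]
  show "x - y \<in> rational_values F w"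
    by (rule rational_valuesI[of _ "p * q' - p' * q" _ "q * q'"])
      (use x y in \<open>auto intro!: cl simp: diff_frac_eq\<close>)
  show "x * y \<in> rational_values F w"
    by (rule rational_valuesI[of _ "p * p'" _ "q * q'"])
      (use x y in \<open>auto intro!: cl\<close>)
  show "x / y \<in> rational_values F w"
  proof (cases "poly p' w = 0")
    case True
    then show ?thesis using y
      by (intro rational_valuesI[of _ 0 _ 1]) (simp_all add: one coeffs_in_0[OF F])
  next
    case False
    then show ?thesis
      by (intro rational_valuesI[of _ "p * q'" _ "q * p'"])
        (use x y in \<open>auto intro!: cl\<close>)
  qed
qed

lemma rat_adjoin_singleton_subset: "rat_adjoin {z} \<subseteq> rational_values \<rat> z"
proof (rule rat_adjoin_least)
  show "{z} \<subseteq> rational_values \<rat> z"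
    by (auto intro!: rational_valuesI[of _ "[:0, 1:]" _ 1] simp: one_pCons coeffs_in_0 subfield_set_Rats)
qed (intro subfield_set_rational_values subfield_set_Rats)

text \<open>The ambient field may carry no order, so the positivity of p^2 + 3 q^2 is used in the
  type \<open>rat\<close>.\<close>

lemma Rats_norm_eq_0:
  fixes x y :: "'a::field_char_0"
  assumes "x \<in> \<rat>" "y \<in> \<rat>" "x\<^sup>2 + 3 * y\<^sup>2 = 0"
  shows "x = 0" "y = 0"
proof -
  obtain p q where x: "x = of_rat p" and y: "y = of_rat q" using assms by (auto elim!: Rats_cases)
  have "of_rat (p\<^sup>2 + 3 * q\<^sup>2) = (0 :: 'a)"
    using assms by (simp add: x y of_rat_add of_rat_mult of_rat_power)
  then have "p\<^sup>2 + 3 * q\<^sup>2 = 0" by simp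
  moreover have "p\<^sup>2 \<ge> 0" "q\<^sup>2 \<ge> 0" by simp_all
  ultimately have "p\<^sup>2 = 0" "q\<^sup>2 = 0" by linarith+
  then show "x = 0" "y = 0" by (simp_all add: x y)
qed

text \<open>Otherwise the leading coefficients would violate \<open>Rats_norm_eq_0\<close>. This
  fact keeps s out of \<rat>(z) and carries transcendence from \<rat> over to \<rat>(s).\<close>

lemma Rats_poly_norm_eq_0:
  fixes p q :: "'a::field_char_0 poly"
  assumes "coeffs_in \<rat> p" "coeffs_in \<rat> q" "p\<^sup>2 + smult 3 (q\<^sup>2) = 0"
  shows "p = 0 \<and> q = 0"
proof -
  have pq: "p\<^sup>2 = smult (- 3) (q\<^sup>2)"
    using assms(3) by (simp add: eq_neg_iff_add_eq_0)
  have "(lead_coeff p)\<^sup>2 = - 3 * (lead_coeff q)\<^sup>2"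
    using arg_cong[OF pq, of lead_coeff] by (simp add: lead_coeff_power lead_coeff_smult del: smult_minus_left)
  moreover have "lead_coeff p \<in> \<rat>" "lead_coeff q \<in> \<rat>" using assms by (simp_all add: coeffs_in_def)
  ultimately have "lead_coeff p = 0" "lead_coeff q = 0"
    using Rats_norm_eq_0[of "lead_coeff p" "lead_coeff q"] by simp_all
  then show ?thesis by simp
qed

section \<open>Conjugation over the base field\<close>

text \<open>A relation rather than a map, so that conjugates can be computed without choosing
  coordinates of a general element of K(s). Once \<open>s\<close> lies outside \<open>K\<close>,
  \<open>conjugate_eq_iff\<close> shows that partners are unique.\<close>

definition conjugate :: "'a::field set \<Rightarrow> 'a \<Rightarrow> 'a \<Rightarrow> 'a \<Rightarrow> bool" where
  "conjugate K s f g \<longleftrightarrow> (\<exists>c\<in>K. \<exists>d\<in>K. f = c + d * s \<and> g = c - d * s)"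

lemma sqrt_notin_rat_adjoin:
  fixes s z :: "'a::field_char_0"
  assumes "\<not> algebraic z" "s\<^sup>2 = - 3"
  shows "s \<notin> rat_adjoin {z}"
proof
  assume "s \<in> rat_adjoin {z}"
  then obtain p q where p: "s = poly p z / poly q z" "coeffs_in \<rat> p" "coeffs_in \<rat> q" "poly q z \<noteq> 0"
    using rat_adjoin_singleton_subset[of z] unfolding rational_values_def by blast
  let ?r = "p\<^sup>2 + smult 3 (q\<^sup>2)"
  have "(poly p z)\<^sup>2 = s\<^sup>2 * (poly q z)\<^sup>2" using p by (simp add: power_divide)
  then have "poly ?r z = 0" unfolding assms(2) by simp
  moreover have "coeffs_in \<rat> ?r"
    using p by (intro coeffs_in_add coeffs_in_smult coeffs_in_power subfield_set_Rats) auto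
  ultimately have "?r = 0"
    using assms(1) transcendental_over_Rats unfolding transcendental_over_def by blast
  then show False using Rats_poly_norm_eq_0 p by fastforce
qed

section \<open>Arithmetic of the conjugation relation\<close>

context
  fixes K :: "'a::field_char_0 set" and s :: 'a
  assumes K: "subfield_set K" and s: "s\<^sup>2 = - 3" and sK: "s \<notin> K"
begin

lemma norm_eq_0:
  assumes "c \<in> K" "d \<in> K" "c\<^sup>2 + 3 * d\<^sup>2 = 0"
  shows "c = 0" "d = 0"
proof -
  have 0: "(c - d * s) * (c + d * s) = 0"
    using assms(3) s by (simp add: algebra_simps power2_eq_square)
  have "d = 0"
  proof (rule ccontr)
    assume "d \<noteq> 0"
    have "d * s = c \<or> d * s = - c" using 0 by (auto simp: eq_neg_iff_add_eq_0 add.commute)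
    then have "d * s / d \<in> K" using assms subfield_setD[OF K] by metis
    then show False using sK \<open>d \<noteq> 0\<close> by simp
  qed
  then show "d = 0" "c = 0" using 0 by simp_all
qed

lemma conjugate_const: "c \<in> K \<Longrightarrow> conjugate K s c c"
  unfolding conjugate_def by (intro bexI[of _ c] bexI[of _ 0]) (auto intro: subfield_setD[OF K])

lemma conjugate_s: "conjugate K s s (- s)"
  unfolding conjugate_def by (intro bexI[of _ 0] bexI[of _ 1]) (auto intro: subfield_setD[OF K])

lemma conjugate_add:
  assumes "conjugate K s f g" "conjugate K s f' g'"
  shows "conjugate K s (f + f') (g + g')"
proof -
  obtain c d c' d' where *: "c \<in> K" "d \<in> K" "f = c + d * s" "g = c - d * s"
    "c' \<in> K" "d' \<in> K" "f' = c' + d' * s" "g' = c' - d' * s"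
    using assms unfolding conjugate_def by blast
  then show ?thesis unfolding conjugate_def
    by (intro bexI[of _ "c + c'"] bexI[of _ "d + d'"]) (auto simp: algebra_simps intro: subfield_setD[OF K])
qed

lemma conjugate_mult:
  assumes "conjugate K s f g" "conjugate K s f' g'"
  shows "conjugate K s (f * f') (g * g')"
proof -
  obtain c d c' d' where *: "c \<in> K" "d \<in> K" "f = c + d * s" "g = c - d * s"
    "c' \<in> K" "d' \<in> K" "f' = c' + d' * s" "g' = c' - d' * s"
    using assms unfolding conjugate_def by blast
  have "d * s * (d' * s) = d * d' * s\<^sup>2" by (simp add: power2_eq_square)
  then have ss: "d * s * (d' * s) = - 3 * d * d'" by (simp add: s)
  have "f * f' = c * c' + d * s * (d' * s) + (c * d' + d * c') * s"
    "g * g' = c * c' + d * s * (d' * s) - (c * d' + d * c') * s"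
    unfolding * by (simp_all add: algebra_simps)
  then show ?thesis unfolding conjugate_def ss
    by (intro bexI[of _ "c * c' + - 3 * d * d'"] bexI[of _ "c * d' + d * c'"])
      (use * in \<open>auto intro!: subfield_setD[OF K]\<close>)
qed

lemma conjugate_uminus: "conjugate K s f g \<Longrightarrow> conjugate K s (- f) (- g)"
  using conjugate_mult[OF conjugate_const[of "- 1"]] subfield_setD[OF K] by simp

lemma conjugate_diff:
  "conjugate K s f g \<Longrightarrow> conjugate K s f' g' \<Longrightarrow> conjugate K s (f - f') (g - g')"
  using conjugate_add[OF _ conjugate_uminus] by (metis diff_conv_add_uminus)

text \<open>The product \<open>f * g\<close> is the norm c^2 + 3 d^2, which vanishes only for c = d
  = 0. The equality tests in the addition law need this.\<close>

lemma conjugate_eq_0_iff: "conjugate K s f g \<Longrightarrow> f = 0 \<longleftrightarrow> g = 0"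
proof -
  assume "conjugate K s f g"
  then obtain c d where *: "c \<in> K" "d \<in> K" "f = c + d * s" "g = c - d * s"
    unfolding conjugate_def by blast
  have "f * g = c\<^sup>2 - d\<^sup>2 * s\<^sup>2" unfolding * by (simp add: power2_eq_square algebra_simps)
  then have "f * g = c\<^sup>2 + 3 * d\<^sup>2" by (simp add: s)
  then show ?thesis using * norm_eq_0[of c d] by auto
qed

lemma conjugate_eq_iff:
  "conjugate K s f g \<Longrightarrow> conjugate K s f' g' \<Longrightarrow> f = f' \<longleftrightarrow> g = g'"
  using conjugate_eq_0_iff[OF conjugate_diff] by fastforce

lemma conjugate_inverse:
  assumes "conjugate K s f g"
  shows "conjugate K s (inverse f) (inverse g)"
proof (cases "f = 0")
  case True
  then show ?thesis using assms conjugate_eq_0_iff[OF assms] conjugate_const[of 0] subfield_setD(1)[OF K]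
    by simp
next
  case False
  then have nz: "f \<noteq> 0" "g \<noteq> 0" using conjugate_eq_0_iff[OF assms] by auto
  from assms obtain c d where *: "c \<in> K" "d \<in> K" "f = c + d * s" "g = c - d * s"
    unfolding conjugate_def by blast
  have "f * g = c\<^sup>2 - d\<^sup>2 * s\<^sup>2" unfolding * by (simp add: power2_eq_square algebra_simps)
  then have n: "f * g = c\<^sup>2 + 3 * d\<^sup>2" by (simp add: s)
  then have K': "f * g \<in> K" using * by (auto intro!: subfield_setD[OF K])
  have "inverse f = g / (f * g)" "inverse g = f / (f * g)" using nz by (simp_all add: field_simps)
  then have "inverse f = c / (f * g) + (- d / (f * g)) * s"
    "inverse g = c / (f * g) - (- d / (f * g)) * s"
    using *(3,4) by (simp_all add: add_divide_distrib diff_divide_distrib)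
  then show ?thesis unfolding conjugate_def
    using K' * by (intro bexI[of _ "c / (f * g)"] bexI[of _ "- d / (f * g)"])
      (auto intro!: subfield_setD(7)[OF K] subfield_setD(3)[OF K] simp del: minus_divide_left[symmetric])
qed

lemma conjugate_divide:
  "conjugate K s f g \<Longrightarrow> conjugate K s f' g' \<Longrightarrow> conjugate K s (f / f') (g / g')"
  using conjugate_mult[OF _ conjugate_inverse] by (simp add: divide_inverse)

lemma conjugate_in: "conjugate K s f g \<Longrightarrow> f \<in> K \<Longrightarrow> f = g"
  using conjugate_eq_iff[OF _ conjugate_const] by blast

text \<open>The addition formulas are rational over \<open>K\<close>, and the tests that select a
  branch have the same outcome on both sides by \<open>conjugate_eq_iff\<close>.\<close>

lemma conjugate_ec_add:
  assumes "rel_ec_point (conjugate K s) P P'" "rel_ec_point (conjugate K s) Q Q'" "a \<in> K"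
  shows "rel_ec_point (conjugate K s) (ec_add a P Q) (ec_add a P' Q')"
proof (cases P; cases Q)
  fix x1 y1 x2 y2 assume P: "P = Affine x1 y1" and Q: "Q = Affine x2 y2"
  obtain x1' y1' x2' y2' where P': "P' = Affine x1' y1'" and Q': "Q' = Affine x2' y2'"
    and r: "conjugate K s x1 x1'" "conjugate K s y1 y1'" "conjugate K s x2 x2'" "conjugate K s y2 y2'"
    using assms(1,2) unfolding P Q by (cases P'; cases Q') auto
  have eq: "x1 = x2 \<longleftrightarrow> x1' = x2'" "y1 = - y2 \<longleftrightarrow> y1' = - y2'"
    using r conjugate_eq_iff conjugate_uminus by blast+
  have num: "conjugate K s (numeral k) (numeral k)" for k
    by (intro conjugate_const subfield_setD(9)[OF K])
  define l where "l = (if x1 = x2 then (3 * (x1 * x1) + a) / (2 * y1) else (y2 - y1) / (x2 - x1))"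
  define l' where "l' = (if x1' = x2' then (3 * (x1' * x1') + a) / (2 * y1') else (y2' - y1') / (x2' - x1'))"
  note intros = conjugate_add conjugate_diff conjugate_mult conjugate_divide num r
    conjugate_const[OF assms(3)]
  have l: "conjugate K s l l'"
  proof -
    \<comment> \<open>Both quotients are conjugate even where a denominator vanishes, because
      \<open>conjugate_inverse\<close> includes \<open>inverse 0 = 0\<close>.\<close>
    have "conjugate K s ((3 * (x1 * x1) + a) / (2 * y1)) ((3 * (x1' * x1') + a) / (2 * y1'))"
      "conjugate K s ((y2 - y1) / (x2 - x1)) ((y2' - y1') / (x2' - x1'))"
      by (intro intros)+
    then show ?thesis unfolding l_def l'_def eq by presburger
  qed
  have "conjugate K s (l * l - x1 - x2) (l' * l' - x1' - x2')" (is "conjugate K s ?x ?x'")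
    by (intro intros l)
  moreover from this have "conjugate K s (l * (x1 - ?x) - y1) (l' * (x1' - ?x') - y1')"
    by (intro intros l)
  moreover have "ec_add a P Q =
      (if x1 = x2 \<and> y1 = - y2 then Infinity else Affine ?x (l * (x1 - ?x) - y1))"
    unfolding P Q ec_add.simps l_def by (simp only: Let_def power2_eq_square)
  moreover have "ec_add a P' Q' =
      (if x1' = x2' \<and> y1' = - y2' then Infinity else Affine ?x' (l' * (x1' - ?x') - y1'))"
    unfolding P' Q' ec_add.simps l'_def by (simp only: Let_def power2_eq_square)
  ultimately show ?thesis by (simp only: eq ec_point.rel_inject simp_thms split: if_split) simp
qed (use assms in \<open>(cases P'; cases Q'; simp)+\<close>)

end

lemma conjugate_ec_group_pow:
  fixes K :: "'a::field_char_0 set"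
  assumes K: "subfield_set K" and s: "s\<^sup>2 = - 3" and sK: "s \<notin> K" and "a \<in> K"
    and "rel_ec_point (conjugate K s) P P'"
  shows "rel_ec_point (conjugate K s) (P [^]\<^bsub>ec_group a b L\<^esub> (n::nat)) (P' [^]\<^bsub>ec_group a b L\<^esub> n)"
  using assms(4,5) by (induction n)
    (simp_all add: nat_pow_def ec_group_def conjugate_ec_add[OF K s sK])

section \<open>Specialization at a transcendental place\<close>

text \<open>Clearing denominators in a relation p(w) = 0 gives a polynomial h with h(z) = 0. As w is
  nonzero, p may be taken with nonzero constant term; the numerator 4 z^2 vanishes at z = 0, so h(0)
  is that constant term times a power of 23550, and h is a nonzero relation for z.\<close>

lemma not_algebraic_inverse_square:
  fixes z :: "'a::field_char_0"
  assumes z: "\<not> algebraic z" and w: "w = 4 * z\<^sup>2 / (23550 - z\<^sup>2)\<^sup>2" and nz: "23550 - z\<^sup>2 \<noteq> 0"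
  shows "\<not> algebraic w"
proof
  assume "algebraic w"
  moreover have "w \<noteq> 0" using z w nz by auto
  ultimately obtain p' :: "int poly" where p': "coeff p' 0 \<noteq> 0" "poly (map_poly of_int p') w = 0"
    using algebraicE'_nonzero by metis
  define p :: "'a poly" where "p = map_poly of_int p'"
  have p: "\<And>i. coeff p i \<in> \<rat>" "coeff p 0 \<noteq> 0" "poly p w = 0"
    using p' by (simp_all add: p_def coeff_map_poly)
  define N D :: "'a poly" where "N = [:0, 0, 4:]" and "D = [:23550, 0, - 1:]\<^sup>2"
  define h where "h = (\<Sum>i\<le>degree p. smult (coeff p i) (N ^ i * D ^ (degree p - i)))"
  have Nz: "poly N z = 4 * z\<^sup>2" and Dz: "poly D z = (23550 - z\<^sup>2)\<^sup>2"
    by (simp_all add: N_def D_def power2_eq_square algebra_simps)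
  have "poly h z = (\<Sum>i\<le>degree p. coeff p i * w ^ i * poly D z ^ degree p)"
    unfolding h_def poly_sum
  proof (intro sum.cong refl)
    fix i assume "i \<in> {..degree p}"
    then have "poly D z ^ degree p = poly D z ^ i * poly D z ^ (degree p - i)"
      by (simp flip: power_add)
    moreover have "poly N z ^ i = w ^ i * poly D z ^ i"
      using nz by (simp add: Nz Dz w power_divide)
    ultimately show "poly (smult (coeff p i) (N ^ i * D ^ (degree p - i))) z
        = coeff p i * w ^ i * poly D z ^ degree p" by (simp add: poly_power)
  qed
  also have "\<dots> = poly p w * poly D z ^ degree p"
    by (simp add: poly_altdef sum_distrib_right)
  finally have "poly h z = 0" using p by simp
  moreover have "coeffs_in \<rat> h"
    unfolding h_def N_def D_def using p
    by (intro coeffs_in_sum coeffs_in_smult coeffs_in_mult coeffs_in_power subfield_set_Rats)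
      (auto simp: coeffs_in_0 subfield_set_Rats)
  ultimately have "h = 0"
    using z transcendental_over_Rats unfolding transcendental_over_def by blast
  have "poly h 0 = (\<Sum>i\<le>degree p. if i = 0 then coeff p 0 * 23550 ^ (2 * degree p) else 0)"
    unfolding h_def poly_sum
    by (intro sum.cong refl) (auto simp: N_def D_def poly_power power_mult power_0_left)
  also have "\<dots> = coeff p 0 * 23550 ^ (2 * degree p)" by simp
  finally show False using p \<open>h = 0\<close> by simp
qed

text \<open>The residue field \<rat>(s) at the place u = \<infinity>; it has to contain s, which
  occurs in the ordinate of the reduction of R.\<close>

definition quad_ext :: "'a::field_char_0 \<Rightarrow> 'a set" where
  "quad_ext s = {c + d * s | c d. c \<in> \<rat> \<and> d \<in> \<rat>}"

lemma quad_extI: "c \<in> \<rat> \<Longrightarrow> d \<in> \<rat> \<Longrightarrow> c + d * s \<in> quad_ext s"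
  by (auto simp: quad_ext_def)

lemma subfield_set_quad_ext:
  assumes s: "s\<^sup>2 = - 3"
  shows "subfield_set (quad_ext s)"
  unfolding subfield_set_def
proof (intro conjI ballI)
  show "1 \<in> quad_ext s" using quad_extI[of 1 0 s] by simp
  fix x y assume "x \<in> quad_ext s" "y \<in> quad_ext s"
  then obtain c d c' d' where x: "x = c + d * s" and y: "y = c' + d' * s"
    and r: "c \<in> \<rat>" "d \<in> \<rat>" "c' \<in> \<rat>" "d' \<in> \<rat>" unfolding quad_ext_def by blast
  have ss: "s * s = - 3" "s * (s * x) = - 3 * x" for x
    using s by (simp_all add: power2_eq_square flip: mult.assoc)
  have "x - y = (c - c') + (d - d') * s" by (simp add: x y algebra_simps)
  then show "x - y \<in> quad_ext s" using r quad_extI[of "c - c'" "d - d'" s] by simp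
  have mult: "(c + d * s) * (c' + d' * s) \<in> quad_ext s"
    if "c \<in> \<rat>" "d \<in> \<rat>" "c' \<in> \<rat>" "d' \<in> \<rat>" for c d c' d'
  proof -
    have "(c + d * s) * (c' + d' * s) = (c * c' - 3 * d * d') + (c * d' + d * c') * s"
      by (simp add: algebra_simps ss)
    then show ?thesis using that quad_extI[of "c * c' - 3 * d * d'" "c * d' + d * c'" s] by simp
  qed
  then show "x * y \<in> quad_ext s" using r by (simp add: x y)
  define n where "n = c'\<^sup>2 + 3 * d'\<^sup>2"
  have "y * (c' - d' * s) = n" by (simp add: y n_def algebra_simps ss power2_eq_square)
  show "x / y \<in> quad_ext s"
  proof (cases "y = 0")
    case True
    then show ?thesis using quad_extI[of 0 0 s] by simp
  next
    case False
    have "n \<noteq> 0"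
      using Rats_norm_eq_0[OF r(3,4)] False unfolding n_def y by auto
    then have "x / y = x * (c' / n + (- d' / n) * s)"
      using False \<open>y * _ = n\<close> by (simp add: divide_simps) (simp add: algebra_simps)
    moreover have "n \<in> \<rat>" using r by (simp add: n_def)
    ultimately show ?thesis using r mult[of c d "c' / n" "- d' / n"] by (simp add: x)
  qed
qed

text \<open>Taking norms: a zero of A + s B is a zero of A^2 + 3 B^2, which has rational
  coefficients.\<close>

lemma transcendental_over_quad_ext:
  assumes s: "s\<^sup>2 = - 3" and w: "\<not> algebraic w"
  shows "transcendental_over (quad_ext s) w"
  unfolding transcendental_over_def
proof (intro allI impI; elim conjE)
  fix p assume "coeffs_in (quad_ext s) p" and p0: "poly p w = 0"
  then have "\<forall>i. \<exists>c d. coeff p i = c + d * s \<and> c \<in> \<rat> \<and> d \<in> \<rat>"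
    unfolding coeffs_in_def quad_ext_def by blast
  then obtain c d where cd: "\<And>i. coeff p i = c i + d i * s" "\<And>i. c i \<in> \<rat>" "\<And>i. d i \<in> \<rat>"
    by metis
  define A B where "A = (\<Sum>i\<le>degree p. monom (c i) i)" and "B = (\<Sum>i\<le>degree p. monom (d i) i)"
  have p: "p = A + smult s B"
  proof (rule poly_eqI)
    fix i
    show "coeff p i = coeff (A + smult s B) i"
    proof (cases "i \<le> degree p")
      case True
      then show ?thesis by (simp add: A_def B_def coeff_sum cd(1) mult.commute)
    next
      case False
      then show ?thesis by (simp add: A_def B_def coeff_sum coeff_eq_0)
    qed
  qed
  have AB: "coeffs_in \<rat> A" "coeffs_in \<rat> B"
    unfolding A_def B_def using cd by (intro coeffs_in_sum subfield_set_Rats; simp add: coeffs_in_def)+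
  have "poly (A\<^sup>2 + smult 3 (B\<^sup>2)) w = (poly A w)\<^sup>2 - s\<^sup>2 * (poly B w)\<^sup>2"
    by (simp add: s)
  also have "\<dots> = poly p w * (poly A w - s * poly B w)"
    by (simp add: p power2_eq_square algebra_simps)
  finally have "poly (A\<^sup>2 + smult 3 (B\<^sup>2)) w = 0" using p0 by simp
  moreover have "coeffs_in \<rat> (A\<^sup>2 + smult 3 (B\<^sup>2))"
    using AB by (intro coeffs_in_add coeffs_in_smult coeffs_in_power subfield_set_Rats) auto
  ultimately have "A\<^sup>2 + smult 3 (B\<^sup>2) = 0"
    using w transcendental_over_Rats unfolding transcendental_over_def by blast
  then show "p = 0" using Rats_poly_norm_eq_0[OF AB] by (simp add: p)
qed

text \<open>Says that \<open>f\<close> lies in the local ring of F(w) at w = 0 and has residue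
  \<open>r\<close>. Poles are described by first scaling with a power of the local
  parameter.\<close>

definition value_at_0 :: "'a::field set \<Rightarrow> 'a \<Rightarrow> 'a \<Rightarrow> 'a \<Rightarrow> bool" where
  "value_at_0 F w f r \<longleftrightarrow> (\<exists>p q. coeffs_in F p \<and> coeffs_in F q \<and> poly q w \<noteq> 0 \<and> poly q 0 \<noteq> 0 \<and>
     f = poly p w / poly q w \<and> r = poly p 0 / poly q 0)"

locale transcendental_element =
  fixes F :: "'a::field_char_0 set" and w :: 'a
  assumes F: "subfield_set F" and w: "transcendental_over F w"
begin

abbreviation val0 :: "'a \<Rightarrow> 'a \<Rightarrow> bool" where "val0 \<equiv> value_at_0 F w"

lemma val0_poly:
  assumes "coeffs_in F p"
  shows "val0 (poly p w) (poly p 0)"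
  unfolding value_at_0_def
  by (intro exI[of _ p] exI[of _ 1])
    (use assms in \<open>simp add: one_pCons coeffs_in_0[OF F] subfield_setD[OF F]\<close>)

lemma val0_const: "c \<in> F \<Longrightarrow> val0 c c"
  using val0_poly[of "[:c:]"] by (simp add: coeffs_in_0[OF F])

lemma val0_numeral: "val0 (numeral k) (numeral k)"
  by (intro val0_const subfield_setD[OF F])

text \<open>Cross-multiplying two representations gives a polynomial that vanishes at the
  transcendental \<open>w\<close>, hence is zero and may be evaluated at 0. Consequently a nonzero
  value certifies a nonzero element, which is how coordinates are later shown to differ.\<close>

lemma val0_unique:
  assumes "val0 f r" "val0 f r'"
  shows "r = r'"
proof -
  obtain p q p' q' where
    1: "coeffs_in F p" "coeffs_in F q" "poly q w \<noteq> 0" "poly q 0 \<noteq> 0"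
      "f = poly p w / poly q w" "r = poly p 0 / poly q 0" and
    2: "coeffs_in F p'" "coeffs_in F q'" "poly q' w \<noteq> 0" "poly q' 0 \<noteq> 0"
      "f = poly p' w / poly q' w" "r' = poly p' 0 / poly q' 0"
    using assms unfolding value_at_0_def by blast
  have "poly (p * q' - p' * q) w = 0" using 1(3,5) 2(3,5) by (simp add: field_simps)
  moreover have "coeffs_in F (p * q' - p' * q)"
    using 1 2 by (intro coeffs_in_diff coeffs_in_mult F)
  ultimately have "p * q' - p' * q = 0" using w unfolding transcendental_over_def by blast
  then have "poly (p * q') 0 = poly (p' * q) 0" by simp
  then show ?thesis unfolding 1(6) 2(6) using 1(4) 2(4) by (simp add: frac_eq_eq)
qed

lemma val0_nonzero: "val0 f r \<Longrightarrow> r \<noteq> 0 \<Longrightarrow> f \<noteq> 0"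
  using val0_unique[OF val0_const[of 0]] subfield_setD(1)[OF F] by blast

lemma val0_diff:
  assumes "val0 f r" "val0 g t" shows "val0 (f - g) (r - t)"
proof -
  obtain p q p' q' where
    1: "coeffs_in F p" "coeffs_in F q" "poly q w \<noteq> 0" "poly q 0 \<noteq> 0"
      "f = poly p w / poly q w" "r = poly p 0 / poly q 0" and
    2: "coeffs_in F p'" "coeffs_in F q'" "poly q' w \<noteq> 0" "poly q' 0 \<noteq> 0"
      "g = poly p' w / poly q' w" "t = poly p' 0 / poly q' 0"
    using assms unfolding value_at_0_def by blast
  then show ?thesis unfolding value_at_0_def
    by (intro exI[of _ "p * q' - p' * q"] exI[of _ "q * q'"])
      (auto intro!: coeffs_in_diff coeffs_in_mult F simp: diff_frac_eq)
qed

lemma val0_mult: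
  assumes "val0 f r" "val0 g t" shows "val0 (f * g) (r * t)"
proof -
  obtain p q p' q' where
    1: "coeffs_in F p" "coeffs_in F q" "poly q w \<noteq> 0" "poly q 0 \<noteq> 0"
      "f = poly p w / poly q w" "r = poly p 0 / poly q 0" and
    2: "coeffs_in F p'" "coeffs_in F q'" "poly q' w \<noteq> 0" "poly q' 0 \<noteq> 0"
      "g = poly p' w / poly q' w" "t = poly p' 0 / poly q' 0"
    using assms unfolding value_at_0_def by blast
  then show ?thesis unfolding value_at_0_def
    by (intro exI[of _ "p * p'"] exI[of _ "q * q'"]) (auto intro!: coeffs_in_mult F)
qed

lemma val0_inverse:
  assumes "val0 f r" "r \<noteq> 0" shows "val0 (1 / f) (1 / r)"
proof -
  have "f \<noteq> 0" by (rule val0_nonzero[OF assms])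
  moreover obtain p q where
    "coeffs_in F p" "coeffs_in F q" "poly q w \<noteq> 0" "poly q 0 \<noteq> 0"
      "f = poly p w / poly q w" "r = poly p 0 / poly q 0"
    using assms(1) unfolding value_at_0_def by blast
  ultimately show ?thesis using assms(2) unfolding value_at_0_def
    by (intro exI[of _ q] exI[of _ p]) auto
qed

lemma val0_divide:
  assumes "val0 f r" "val0 g t" "t \<noteq> 0" shows "val0 (f / g) (r / t)"
  using val0_mult[OF assms(1) val0_inverse[OF assms(2,3)]] by simp

lemma val0_power: "val0 f r \<Longrightarrow> val0 (f ^ n) (r ^ n)"
  by (induction n) (use subfield_setD(2)[OF F] in \<open>simp_all add: val0_const val0_mult\<close>)

lemma val0_uminus: "val0 f r \<Longrightarrow> val0 (- f) (- r)"
  using val0_diff[OF val0_const[of 0]] subfield_setD(1)[OF F] by simp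

lemma val0_add: "val0 f r \<Longrightarrow> val0 g t \<Longrightarrow> val0 (f + g) (r + t)"
  using val0_diff[OF _ val0_uminus] by (metis diff_minus_eq_add)

text \<open>Up to scaling by \<open>v\<close>, the curve reduces to the cusp \<open>y\<^sup>2 = x\<^sup>3\<close>, on which
  \<open>c \<mapsto> (1 / c\<^sup>2, 1 / c\<^sup>3)\<close> turns addition of parameters into addition of points.\<close>

lemma ec_multiple_at_cusp:
  assumes x: "val0 (v\<^sup>2 * x) (1 / c\<^sup>2)" and y: "val0 (v ^ 3 * y) (1 / c ^ 3)"
    and a: "val0 (v ^ 4 * a) 0" and c: "c \<noteq> 0"
  shows "\<exists>xn yn. Affine x y [^]\<^bsub>ec_group a b L\<^esub> Suc n = Affine xn yn \<and>
     val0 (v\<^sup>2 * xn) (1 / (of_nat (Suc n) * c)\<^sup>2) \<and> val0 (v ^ 3 * yn) (1 / (of_nat (Suc n) * c) ^ 3)"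
proof (induction n)
  case 0
  show ?case using x y by (simp add: ec_group_def nat_pow_def)
next
  case (Suc n)
  then obtain xn yn where eq: "Affine x y [^]\<^bsub>ec_group a b L\<^esub> Suc n = Affine xn yn"
    and xn: "val0 (v\<^sup>2 * xn) (1 / (of_nat (Suc n) * c)\<^sup>2)"
    and yn: "val0 (v ^ 3 * yn) (1 / (of_nat (Suc n) * c) ^ 3)" by blast
  have step: "Affine x y [^]\<^bsub>ec_group a b L\<^esub> Suc (Suc n) = ec_add a (Affine xn yn) (Affine x y)"
    using eq by (simp add: ec_group_def nat_pow_def)
  have v: "v \<noteq> 0" using val0_nonzero[OF x] c by auto
  define m :: 'a where "m = of_nat (Suc n)"
  have m: "m \<noteq> 0" "m + 1 \<noteq> 0" "of_nat (Suc (Suc n)) = m + 1"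
    unfolding m_def by (metis of_nat_neq_0, metis of_nat_Suc of_nat_neq_0 add.commute, simp)
  note xn = xn[folded m_def] and yn = yn[folded m_def]
  define l where "l = (if xn = x then (3 * xn\<^sup>2 + a) / (2 * yn) else (y - yn) / (x - xn))"
  \<comment> \<open>The fraction is the slope of the chord through the parameters
    \<open>m * c\<close> and \<open>c\<close> on the cusp; at \<open>m = 1\<close> it becomes the
    tangent slope \<open>3 / (2 * c)\<close>.\<close>
  have sum: "val0 (v * l) ((m\<^sup>2 + m + 1) / (m * (m + 1) * c)) \<and> \<not> (xn = x \<and> yn = - y)"
  proof (cases "n = 0")
    case True
    then have m1: "m = 1" by (simp add: m_def)
    have "xn = x \<and> yn = y" using eq True by (simp add: ec_group_def nat_pow_def)
    moreover have "y \<noteq> 0" using val0_nonzero[OF y] c by auto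
    moreover have "val0 ((3 * (v\<^sup>2 * x)\<^sup>2 + v ^ 4 * a) / (2 * (v ^ 3 * y)))
        ((3 * (1 / c\<^sup>2)\<^sup>2 + 0) / (2 * (1 / c ^ 3)))"
      by (intro val0_add val0_divide val0_mult val0_power val0_numeral x y a) (use c in simp)
    moreover have "(3 * (v\<^sup>2 * x)\<^sup>2 + v ^ 4 * a) / (2 * (v ^ 3 * y)) = v * ((3 * x\<^sup>2 + a) / (2 * y))"
      using v \<open>y \<noteq> 0\<close> by (simp add: divide_simps) (simp add: algebra_simps power2_eq_square power3_eq_cube power4_eq_xxxx)
    moreover have "(3 * (1 / c\<^sup>2)\<^sup>2 + 0) / (2 * (1 / c ^ 3)) = 3 / (2 * c)"
      using c by (simp add: field_simps power2_eq_square power3_eq_cube)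
    ultimately show ?thesis by (auto simp: l_def m1 mult.commute)
  next
    case False
    \<comment> \<open>In characteristic 0 the number \<open>m = n + 1\<close> differs from 1 and -1,
      so the limits of the two abscissas differ and the addition is a chord.\<close>
    have "m - 1 = of_nat n" by (simp add: m_def)
    then have "m - 1 \<noteq> 0" using False by simp
    then have "m\<^sup>2 - 1 \<noteq> 0" using m by (simp add: power2_eq_1_iff eq_neg_iff_add_eq_0)
    then have d: "1 / c\<^sup>2 - 1 / (m * c)\<^sup>2 \<noteq> 0" using c m by (simp add: field_simps)
    have "val0 (v\<^sup>2 * x - v\<^sup>2 * xn) (1 / c\<^sup>2 - 1 / (m * c)\<^sup>2)" by (intro val0_diff x xn)
    from val0_nonzero[OF this d] have "xn \<noteq> x" by auto
    have "val0 ((v ^ 3 * y - v ^ 3 * yn) / (v\<^sup>2 * x - v\<^sup>2 * xn))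
      ((1 / c ^ 3 - 1 / (m * c) ^ 3) / (1 / c\<^sup>2 - 1 / (m * c)\<^sup>2))"
      by (intro val0_divide val0_diff x y xn yn d)
    moreover have "(v ^ 3 * y - v ^ 3 * yn) / (v\<^sup>2 * x - v\<^sup>2 * xn) = v * l"
      using v \<open>xn \<noteq> x\<close>
      by (simp add: l_def divide_simps power2_eq_square power3_eq_cube) (simp add: algebra_simps)
    moreover have "(1 / c ^ 3 - 1 / (m * c) ^ 3) / (1 / c\<^sup>2 - 1 / (m * c)\<^sup>2)
        = (m\<^sup>2 + m + 1) / (m * (m + 1) * c)"
    proof -
      have "1 / c ^ 3 - 1 / (m * c) ^ 3 = (m - 1) * (m\<^sup>2 + m + 1) / (m * c) ^ 3"
        using c m by (simp add: divide_simps) (simp add: power2_eq_square power3_eq_cube algebra_simps)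
      moreover have "1 / c\<^sup>2 - 1 / (m * c)\<^sup>2 = (m - 1) * (m + 1) / (m * c)\<^sup>2"
        using c m by (simp add: divide_simps) (simp add: power2_eq_square algebra_simps)
      ultimately show ?thesis
        using \<open>m - 1 \<noteq> 0\<close> c m by (simp add: power2_eq_square power3_eq_cube)
    qed
    ultimately show ?thesis using \<open>xn \<noteq> x\<close> by simp
  qed
  define x3 where "x3 = l\<^sup>2 - xn - x"
  define y3 where "y3 = l * (xn - x3) - yn"
  have "ec_add a (Affine xn yn) (Affine x y) = Affine x3 y3"
    using sum by (simp add: x3_def y3_def l_def Let_def)
  moreover have x3: "val0 (v\<^sup>2 * x3) (1 / ((m + 1) * c)\<^sup>2)"
  proof -
    have "val0 ((v * l)\<^sup>2 - v\<^sup>2 * xn - v\<^sup>2 * x)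
        (((m\<^sup>2 + m + 1) / (m * (m + 1) * c))\<^sup>2 - 1 / (m * c)\<^sup>2 - 1 / c\<^sup>2)"
      by (intro val0_diff val0_power x xn conjunct1[OF sum])
    moreover have "(v * l)\<^sup>2 - v\<^sup>2 * xn - v\<^sup>2 * x = v\<^sup>2 * x3"
      by (simp add: x3_def algebra_simps power_mult_distrib)
    moreover have "((m\<^sup>2 + m + 1) / (m * (m + 1) * c))\<^sup>2 - 1 / (m * c)\<^sup>2 - 1 / c\<^sup>2 = 1 / ((m + 1) * c)\<^sup>2"
      using c m by (simp add: divide_simps) (simp add: power2_eq_square algebra_simps)
    ultimately show ?thesis by simp
  qed
  moreover have "val0 (v ^ 3 * y3) (1 / ((m + 1) * c) ^ 3)"
  proof -
    have "val0 (v * l * (v\<^sup>2 * xn - v\<^sup>2 * x3) - v ^ 3 * yn)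
        ((m\<^sup>2 + m + 1) / (m * (m + 1) * c) * (1 / (m * c)\<^sup>2 - 1 / ((m + 1) * c)\<^sup>2) - 1 / (m * c) ^ 3)"
      by (intro val0_diff val0_mult xn yn x3 conjunct1[OF sum])
    moreover have "v * l * (v\<^sup>2 * xn - v\<^sup>2 * x3) - v ^ 3 * yn = v ^ 3 * y3"
      by (simp add: y3_def algebra_simps power2_eq_square power3_eq_cube)
    moreover have "(m\<^sup>2 + m + 1) / (m * (m + 1) * c) * (1 / (m * c)\<^sup>2 - 1 / ((m + 1) * c)\<^sup>2) - 1 / (m * c) ^ 3
        = 1 / ((m + 1) * c) ^ 3"
      using c m by (simp add: divide_simps) (simp add: power2_eq_square power3_eq_cube algebra_simps)
    ultimately show ?thesis by simp
  qed
  ultimately show ?case unfolding step m by blast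
qed

end

section \<open>The point on the Nagao curve\<close>

lemma ec_group_sel [simp]:
  "x \<otimes>\<^bsub>ec_group a b K\<^esub> y = ec_add a x y" "\<one>\<^bsub>ec_group a b K\<^esub> = Infinity"
  "carrier (ec_group a b UNIV) = ec_on a b"
  by (auto simp: ec_group_def ec_on_def)

text \<open>All groups E(K) carry one and the same law on different carriers, so they can be treated
  as subgroups of the points over the ambient field.\<close>

lemma ec_group_restrict:
  "ec_group a b K = (ec_group a b UNIV)\<lparr>carrier := carrier (ec_group a b K)\<rparr>"
  by (simp add: ec_group_def)

lemma Affine_in_ec_group:
  "Affine x y \<in> carrier (ec_group a b K) \<longleftrightarrow> x \<in> K \<and> y \<in> K \<and> Affine x y \<in> ec_on a b"
  by (auto simp: ec_group_def)

lemma carrier_ec_group_subset: "carrier (ec_group a b K) \<subseteq> ec_on a b"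
  by (auto simp: ec_group_def ec_on_def)

section \<open>The abelian group of points over the ambient field and its subgroups E(K)\<close>

context nonsingular_cubic
begin

lemma comm_group_ec_group: "comm_group (ec_group a b UNIV)"
proof (rule comm_groupI)
  fix x assume "x \<in> carrier (ec_group a b UNIV)"
  then show "\<exists>y\<in>carrier (ec_group a b UNIV). y \<otimes>\<^bsub>ec_group a b UNIV\<^esub> x = \<one>\<^bsub>ec_group a b UNIV\<^esub>"
    by (intro bexI[of _ "ec_opp x"]) simp_all
next
  fix x y assume "x \<in> carrier (ec_group a b UNIV)" "y \<in> carrier (ec_group a b UNIV)"
  then show "x \<otimes>\<^bsub>ec_group a b UNIV\<^esub> y = y \<otimes>\<^bsub>ec_group a b UNIV\<^esub> x"
    unfolding ec_group_sel by (rule ec_add_commute)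
qed (simp_all add: ec_add_on ec_add_assoc)

lemma inv_ec_group: "x \<in> ec_on a b \<Longrightarrow> inv\<^bsub>ec_group a b UNIV\<^esub> x = ec_opp x"
  using group.inv_equality[OF comm_group.axioms(2)[OF comm_group_ec_group], of "ec_opp x" x] by simp

lemma subgroup_ec_group:
  assumes K: "subfield_set K" and a: "a \<in> K"
  shows "subgroup (carrier (ec_group a b K)) (ec_group a b UNIV)"
proof (rule group.subgroupI[OF comm_group.axioms(2)[OF comm_group_ec_group]])
  note cl = subfield_setD[OF K]
  show "carrier (ec_group a b K) \<subseteq> carrier (ec_group a b UNIV)"
    using carrier_ec_group_subset by auto
  show "carrier (ec_group a b K) \<noteq> {}" by (auto simp: ec_group_def)
  fix p assume p: "p \<in> carrier (ec_group a b K)"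
  then have on_p: "p \<in> ec_on a b" using carrier_ec_group_subset by blast
  show "inv\<^bsub>ec_group a b UNIV\<^esub> p \<in> carrier (ec_group a b K)"
    using p unfolding inv_ec_group[OF on_p] by (auto simp: ec_group_def cl)
  fix q assume q: "q \<in> carrier (ec_group a b K)"
  then have on_q: "q \<in> ec_on a b" using carrier_ec_group_subset by blast
  show "p \<otimes>\<^bsub>ec_group a b UNIV\<^esub> q \<in> carrier (ec_group a b K)"
  proof (cases p; cases q)
    fix x1 y1 x2 y2 assume pq: "p = Affine x1 y1" "q = Affine x2 y2"
    then have in_K: "x1 \<in> K" "y1 \<in> K" "x2 \<in> K" "y2 \<in> K"
      using p q by (auto simp: Affine_in_ec_group)
    define l where "l = (if x1 = x2 then (3 * x1\<^sup>2 + a) / (2 * y1) else (y2 - y1) / (x2 - x1))"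
    have l: "l \<in> K" unfolding l_def using in_K a by (auto intro!: cl)
    have "ec_add a p q = Infinity \<or> ec_add a p q = Affine (l\<^sup>2 - x1 - x2) (l * (x1 - (l\<^sup>2 - x1 - x2)) - y1)"
      unfolding pq ec_add.simps l_def Let_def by metis
    moreover have "ec_add a p q \<in> ec_on a b" by (rule ec_add_on[OF on_p on_q])
    moreover have "Infinity \<in> carrier (ec_group a b K)" by (simp add: ec_group_def)
    ultimately show ?thesis
      using in_K l by (auto simp: Affine_in_ec_group simp del: Affine_on intro!: cl)
  qed (use p q in simp_all)
qed

end

text \<open>Transcendence is required of 1 / u because this is the local parameter at which values
  are taken.\<close>

locale nagao_curve =
  fixes s u :: "'a::field_char_0"
  assumes s: "s\<^sup>2 = - 3" and u: "\<not> algebraic (1 / u)"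
begin

abbreviation "F \<equiv> quad_ext s"
abbreviation "w \<equiv> 1 / u"
abbreviation "a \<equiv> nagao_a u"
abbreviation "b \<equiv> nagao_b u"

sublocale transcendental_element F w
  by unfold_locales (rule subfield_set_quad_ext[OF s], rule transcendental_over_quad_ext[OF s u])

lemma u_nonzero: "u \<noteq> 0"
  using u by auto

lemma ss: "s * s = - 3" "s * (s * x) = - 3 * x"
  using s by (simp_all add: power2_eq_square flip: mult.assoc)

lemma s_in: "s \<in> F"
  using quad_extI[of 0 1 s] by simp

lemma s_nonzero: "s \<noteq> 0"
  using s by auto

lemma val0_poly_eq:
  assumes "f = poly p w" "coeffs_in F p" "r = poly p 0"
  shows "val0 f r"
  using val0_poly[OF assms(2)] assms by simp

lemmas in_F = subfield_setD[OF F] coeffs_in_0[OF F] s_in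

text \<open>Reversing the coefficients turns a root \<open>u\<close> of \<open>p\<close> into a root
  \<open>1 / u\<close> of \<open>reflect_poly p\<close>.\<close>

lemma poly_u_nonzero:
  assumes "coeffs_in F p" "p \<noteq> 0"
  shows "poly p u \<noteq> 0"
proof
  assume "poly p u = 0"
  then have "poly (reflect_poly p) w = 0"
    using u_nonzero poly_reflect_poly_nz[of w p] by (simp add: divide_inverse)
  moreover have "coeffs_in F (reflect_poly p)"
    using assms by (auto simp: coeffs_in_def coeff_reflect_poly in_F)
  ultimately have "reflect_poly p = 0" using w unfolding transcendental_over_def by blast
  then show False using assms by simp
qed

text \<open>The discriminant is a polynomial expression in the transcendental \<open>u\<close>; that
  this polynomial is nonzero is read off from its constant term.\<close>

lemma nonsingular_nagao: "4 * a ^ 3 + 27 * b\<^sup>2 \<noteq> 0"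
proof -
  define A :: "'a poly" where "A = [:-340079781902569707, -18899197014000, 38353513056, -4435200, -432:]"
  define B :: "'a poly" where "B = [:76302327326969661771531494, 7556017995191414902800,
    -18532375351306853196, 5893342291009600, -870054636672, 53222400, 3456:]"
  have A: "poly A u = a" and B: "poly B u = b"
    unfolding A_def B_def nagao_a_def nagao_b_def
    by (simp_all add: algebra_simps power_numeral_reduce)
  have "coeffs_in F (smult 4 (A ^ 3) + smult 27 (B\<^sup>2))"
    unfolding A_def B_def
    by (intro coeffs_in_add coeffs_in_smult coeffs_in_power F in_F) (simp_all add: in_F)
  moreover have "poly (smult 4 (A ^ 3) + smult 27 (B\<^sup>2)) 0 \<noteq> 0"
    by (simp add: A_def B_def)
  then have "smult 4 (A ^ 3) + smult 27 (B\<^sup>2) \<noteq> 0" by force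
  ultimately have "poly (smult 4 (A ^ 3) + smult 27 (B\<^sup>2)) u \<noteq> 0" by (rule poly_u_nonzero)
  then show ?thesis by (simp add: A B)
qed

sublocale nonsingular_cubic a b
  by unfold_locales (rule nonsingular_nagao)

lemma Q_on: "Affine (Q_x s u) (Q_y s u) \<in> ec_on a b"
  unfolding Affine_on Q_x_def Q_y_def nagao_a_def nagao_b_def
  by (simp add: power_numeral_reduce algebra_simps ss)

text \<open>These are the coordinates of R. Conjugation sends R to - R, so the abscissa lies in
  \<rat>(u) and the ordinate is s times the element \<open>Ry'\<close> of \<rat>(u).\<close>

definition Rx :: 'a where "Rx = - 1318410326 - 626800 * u - 36 * u\<^sup>2"
definition Ry' :: 'a where "Ry' = - 24269332059000 - 20759308044 * u - 3391200 * u\<^sup>2 - 96 * u ^ 3"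
definition Ry :: 'a where "Ry = s * Ry'"

lemma Q_minus_conjugate:
  "ec_add a (Affine (Q_x s u) (Q_y s u)) (ec_opp (Affine (Q_x (- s) u) (Q_y (- s) u))) = Affine Rx Ry"
proof -
  \<comment> \<open>The slope of the chord through Q and the negative of its conjugate. It is a
    polynomial because the factor 27432 u - 168316272 of the difference of abscissas divides the
    difference of ordinates.\<close>
  define l where "l = s * (- 30728 - 2 * u)"
  have d: "Q_x (- s) u - Q_x s u = - (2 * s) * (27432 * u - 168316272)"
    by (simp add: Q_x_def algebra_simps)
  have "poly [:- 168316272, 27432:] u \<noteq> 0"
    by (rule poly_u_nonzero) (simp_all add: in_F)
  moreover have "poly [:- 168316272, 27432:] u = 27432 * u - 168316272" by simp
  ultimately have "27432 * u - 168316272 \<noteq> 0" by metis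
  then have "Q_x (- s) u - Q_x s u \<noteq> 0"
    unfolding d using s_nonzero by (intro no_zero_divisors) simp_all
  then have "Q_x (- s) u \<noteq> Q_x s u" by simp
  then have ne: "\<not> (Q_x s u = Q_x (- s) u \<and> Q_y s u = - (- Q_y (- s) u))" by auto
  have "l * (Q_x (- s) u - Q_x s u) = - Q_y (- s) u - Q_y s u"
    unfolding d l_def Q_y_def by (simp add: power_numeral_reduce algebra_simps ss)
  moreover have "(Q_x s u - Q_x (- s) u) * (3 * (Q_x s u)\<^sup>2 + a - 2 * l * Q_y s u) =
      (Q_x s u - Q_x (- s) u) * ((Q_x s u - Q_x (- s) u) * (2 * Q_x s u + Q_x (- s) u - l\<^sup>2))"
    unfolding l_def Q_x_def Q_y_def nagao_a_def by (simp add: power_numeral_reduce algebra_simps ss)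
  ultimately have "ec_slope a (Q_x s u) (Q_y s u) (Q_x (- s) u) (- Q_y (- s) u) l"
    using \<open>Q_x (- s) u \<noteq> Q_x s u\<close> by (simp add: ec_slope_def)
  note add = ec_add_slope[OF this ne]
  have "l\<^sup>2 - Q_x s u - Q_x (- s) u = Rx"
    unfolding l_def Q_x_def Rx_def by (simp add: power_numeral_reduce algebra_simps ss)
  moreover have "l * (Q_x s u - Rx) - Q_y s u = Ry"
    unfolding l_def Q_x_def Rx_def Ry_def Ry'_def Q_y_def by (simp add: power_numeral_reduce algebra_simps ss)
  ultimately show ?thesis unfolding ec_opp.simps add by simp
qed

definition tangent_num :: 'a where "tangent_num = 3 * Rx\<^sup>2 + a"
text \<open>The numerator of x(2 R) - x(R) over the denominator \<open>4 * Ry^2\<close>. Its terms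
  of degree 8 in u cancel, since R and 2 R have the same abscissa at the place.\<close>

definition doubling_num :: 'a where "doubling_num = tangent_num\<^sup>2 - 12 * Rx * Ry\<^sup>2"

text \<open>Multiplication by w to the degree in u reverses the coefficient list, so each value is a
  leading coefficient. For \<open>a\<close> the exponent 8 exceeds the degree 4, which gives 0: the
  cubic looks cuspidal at this scale.\<close>

lemma val0_R:
  "val0 (w\<^sup>2 * Rx) (- 36)" "val0 (w ^ 3 * Ry) (- 96 * s)" "val0 (w ^ 4 * tangent_num) 3456"
  "val0 ((w\<^sup>2) ^ 4 * a) 0" "val0 (w ^ 7 * doubling_num) (- 146644992000)" "val0 w 0"
proof -
  show "val0 (w\<^sup>2 * Rx) (- 36)"
    by (rule val0_poly_eq[of _ "[:-36, -626800, -1318410326:]"])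
      (use u_nonzero in \<open>simp_all add: Rx_def in_F field_simps power_numeral_reduce\<close>)
  have "val0 (w ^ 3 * Ry') (- 96)"
    by (rule val0_poly_eq[of _ "[:-96, -3391200, -20759308044, -24269332059000:]"])
      (use u_nonzero in \<open>simp_all add: Ry'_def in_F field_simps power_numeral_reduce\<close>)
  from val0_mult[OF this val0_const[OF s_in]] show "val0 (w ^ 3 * Ry) (- 96 * s)"
    by (simp add: Ry_def mult_ac)
  have tangent_num: "tangent_num = 4874537581207709121 + 4939378357006800 * u + 1501764863472 * u\<^sup>2 + 130953600 * u ^ 3 + 3456 * u ^ 4"
    unfolding tangent_num_def Rx_def nagao_a_def by (simp add: power_numeral_reduce algebra_simps)
  show "val0 (w ^ 4 * tangent_num) 3456"
    by (rule val0_poly_eq[of _ "[:3456, 130953600, 1501764863472, 4939378357006800, 4874537581207709121:]"])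
      (use u_nonzero in \<open>simp_all add: tangent_num in_F field_simps power_numeral_reduce\<close>)
  show "val0 ((w\<^sup>2) ^ 4 * a) 0"
    by (rule val0_poly_eq[of _ "[:0, 0, 0, 0, -432, -4435200, 38353513056, -18899197014000, -340079781902569707:]"])
      (use u_nonzero in \<open>simp_all add: nagao_a_def in_F field_simps power_numeral_reduce\<close>)
  have "Ry\<^sup>2 = - 3 * Ry'\<^sup>2" by (simp add: Ry_def power_mult_distrib s)
  then have "doubling_num = tangent_num\<^sup>2 + 36 * Rx * Ry'\<^sup>2" by (simp add: doubling_num_def)
  also have "\<dots> = - 4194478637105867571259318268069407359 - 12961176182114720412851434575266400 * u
      - 12728621240566028146320875328672 * u\<^sup>2 - 5536002542357126729826144000 * u ^ 3
      - 1206419932225724757435648 * u ^ 4 - 141391643031630950400 * u ^ 5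
      - 7670436630405120 * u ^ 6 - 146644992000 * u ^ 7"
    unfolding tangent_num Rx_def Ry'_def by (simp add: power_numeral_reduce algebra_simps)
  finally have doubling_num: "doubling_num = \<dots>" .
  show "val0 (w ^ 7 * doubling_num) (- 146644992000)"
    by (rule val0_poly_eq[of _ "[:-146644992000, -7670436630405120, -141391643031630950400,
      -1206419932225724757435648, -5536002542357126729826144000, -12728621240566028146320875328672,
      -12961176182114720412851434575266400, -4194478637105867571259318268069407359:]"])
      (use u_nonzero in \<open>simp_all add: doubling_num in_F field_simps power_numeral_reduce\<close>)
  show "val0 w 0" by (rule val0_poly_eq[of _ "[:0, 1:]"]) (simp_all add: in_F)
qed

text \<open>R and 2 R become opposite at the place, so their chord becomes vertical and x(3 R) grows
  like u^4 instead of u^2. In the scale \<open>w^2\<close>, one factor 1 / u comes from the change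
  of coordinates and the other is the local parameter.\<close>

lemma triple_R:
  obtains x y c where "ec_add a (Affine Rx Ry) (ec_add a (Affine Rx Ry) (Affine Rx Ry)) = Affine x y"
    "val0 ((w\<^sup>2)\<^sup>2 * x) (1 / c\<^sup>2)" "val0 ((w\<^sup>2) ^ 3 * y) (1 / c ^ 3)" "c \<noteq> 0"
proof -
  have "w ^ 3 * Ry \<noteq> 0" by (rule val0_nonzero[OF val0_R(2)]) (simp add: s_nonzero)
  then have Ry: "Ry \<noteq> 0" by auto
  define l where "l = tangent_num / (2 * Ry)"
  define x2 where "x2 = l\<^sup>2 - Rx - Rx"
  define y2 where "y2 = l * (Rx - x2) - Ry"
  have RR: "ec_add a (Affine Rx Ry) (Affine Rx Ry) = Affine x2 y2"
    using Ry by (simp add: Let_def l_def x2_def y2_def tangent_num_def)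
  \<comment> \<open>The reduction of R is a flex of the nodal cubic; its tangent has slope
    \<open>6 * s\<close>, and doubling gives (-36, 96 s), the negative of the reduction of
    R.\<close>
  have "val0 (w ^ 4 * tangent_num / (2 * (w ^ 3 * Ry))) (3456 / (2 * (- 96 * s)))"
    by (intro val0_divide val0_mult val0_R val0_numeral) (simp add: s_nonzero)
  moreover have "w ^ 4 * tangent_num / (2 * (w ^ 3 * Ry)) = w * l"
    using u_nonzero Ry by (simp add: l_def power_numeral_reduce)
  moreover have "3456 / (2 * (- 96 * s)) = 6 * s"
    using s_nonzero by (simp add: divide_simps ss)
  ultimately have l: "val0 (w * l) (6 * s)" by simp
  have "val0 ((w * l)\<^sup>2 - w\<^sup>2 * Rx - w\<^sup>2 * Rx) ((6 * s)\<^sup>2 - (- 36) - (- 36))"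
    by (intro val0_diff val0_power val0_R l)
  moreover have "(w * l)\<^sup>2 - w\<^sup>2 * Rx - w\<^sup>2 * Rx = w\<^sup>2 * x2"
    by (simp add: x2_def power2_eq_square algebra_simps)
  moreover have "(6 * s)\<^sup>2 - (- 36) - (- 36) = - 36" by (simp add: power_mult_distrib s)
  ultimately have x2: "val0 (w\<^sup>2 * x2) (- 36)" by (simp only:)
  have "val0 (w * l * (w\<^sup>2 * Rx - w\<^sup>2 * x2) - w ^ 3 * Ry) (6 * s * (- 36 - - 36) - (- 96 * s))"
    by (intro val0_diff val0_mult val0_R(1,2) l x2)
  moreover have "w * l * (w\<^sup>2 * Rx - w\<^sup>2 * x2) - w ^ 3 * Ry = w ^ 3 * y2"
    by (simp add: y2_def power_numeral_reduce algebra_simps add_divide_distrib)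
  ultimately have y2: "val0 (w ^ 3 * y2) (96 * s)" by simp
  \<comment> \<open>With weight \<open>w^2\<close> both abscissas have the value -36, so the weight
    \<open>w\<close> is used to isolate the next coefficient of their difference.\<close>
  have "val0 (w ^ 7 * doubling_num / (4 * (w ^ 3 * Ry)\<^sup>2)) (- 146644992000 / (4 * (- 96 * s)\<^sup>2))"
    by (intro val0_divide val0_mult val0_power val0_R val0_numeral) (simp add: s_nonzero)
  moreover have "w ^ 7 * doubling_num / (4 * (w ^ 3 * Ry)\<^sup>2) = w * (x2 - Rx)"
    using u_nonzero Ry by (simp add: x2_def l_def doubling_num_def divide_simps power_numeral_reduce)
  moreover have "- 146644992000 / (4 * (- 96 * s)\<^sup>2) = 1326000"
    by (simp add: power_mult_distrib s)
  ultimately have d: "val0 (w * (x2 - Rx)) 1326000" by simp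
  then have "w * (x2 - Rx) \<noteq> 0" by (rule val0_nonzero) simp
  then have ne: "Rx \<noteq> x2" by auto
  define m where "m = (y2 - Ry) / (x2 - Rx)"
  define x3 where "x3 = m\<^sup>2 - Rx - x2"
  define y3 where "y3 = m * (Rx - x3) - Ry"
  have RRR: "ec_add a (Affine Rx Ry) (Affine x2 y2) = Affine x3 y3"
    using ne by (simp add: Let_def m_def x3_def y3_def)
  \<comment> \<open>The limit of the scaled chord slope. At the weights \<open>w^4\<close> and
    \<open>w^6\<close> the coordinates of R and 2 R contribute 0, so those of 3 R tend to
    \<open>e^2\<close> and \<open>- (e ^ 3)\<close>, which forces the cusp parameter
    \<open>c = - 1 / e\<close>.\<close>
  define e where "e = 192 * s / 1326000"
  have "val0 ((w ^ 3 * y2 - w ^ 3 * Ry) / (w * (x2 - Rx))) ((96 * s - - 96 * s) / 1326000)"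
    by (intro val0_divide val0_diff val0_R y2 d) simp
  moreover have "(w ^ 3 * y2 - w ^ 3 * Ry) / (w * (x2 - Rx)) = w\<^sup>2 * m"
    using u_nonzero ne by (simp add: m_def divide_simps power_numeral_reduce)
  moreover have "(96 * s - - 96 * s) / 1326000 = e" by (simp add: e_def)
  ultimately have m: "val0 (w\<^sup>2 * m) e" by simp
  have "val0 ((w\<^sup>2 * m)\<^sup>2 - w\<^sup>2 * (w\<^sup>2 * Rx) - w\<^sup>2 * (w\<^sup>2 * x2)) (e\<^sup>2 - 0\<^sup>2 * - 36 - 0\<^sup>2 * - 36)"
    by (intro val0_diff val0_mult val0_power val0_R m x2)
  moreover have "(w\<^sup>2 * m)\<^sup>2 - w\<^sup>2 * (w\<^sup>2 * Rx) - w\<^sup>2 * (w\<^sup>2 * x2) = (w\<^sup>2)\<^sup>2 * x3"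
    by (simp add: x3_def power2_eq_square algebra_simps add_divide_distrib diff_divide_distrib)
  ultimately have x3: "val0 ((w\<^sup>2)\<^sup>2 * x3) (e\<^sup>2)" by simp
  have "val0 (w\<^sup>2 * m * (w\<^sup>2 * (w\<^sup>2 * Rx) - (w\<^sup>2)\<^sup>2 * x3) - w ^ 3 * (w ^ 3 * Ry))
      (e * (0\<^sup>2 * - 36 - e\<^sup>2) - 0 ^ 3 * (- 96 * s))"
    by (intro val0_diff val0_mult val0_power val0_R m x3)
  moreover have "w\<^sup>2 * m * (w\<^sup>2 * (w\<^sup>2 * Rx) - (w\<^sup>2)\<^sup>2 * x3) - w ^ 3 * (w ^ 3 * Ry) = (w\<^sup>2) ^ 3 * y3"
    by (simp add: y3_def power_numeral_reduce algebra_simps add_divide_distrib diff_divide_distrib)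
  ultimately have y3: "val0 ((w\<^sup>2) ^ 3 * y3) (- (e ^ 3))"
    by (simp add: power_numeral_reduce)
  show ?thesis
  proof (rule that)
    show "ec_add a (Affine Rx Ry) (ec_add a (Affine Rx Ry) (Affine Rx Ry)) = Affine x3 y3"
      unfolding RR RRR ..
    show "val0 ((w\<^sup>2)\<^sup>2 * x3) (1 / (- 1 / e)\<^sup>2)" using x3 by (simp add: power_divide)
    show "val0 ((w\<^sup>2) ^ 3 * y3) (1 / (- 1 / e) ^ 3)" using y3 by (simp add: power_divide)
    show "- 1 / e \<noteq> 0" using s_nonzero by (simp add: e_def)
  qed
qed

lemma R_nontorsion:
  fixes n :: nat
  assumes "n \<ge> 1"
  shows "Affine Rx Ry [^]\<^bsub>ec_group a b UNIV\<^esub> n \<noteq> Infinity"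
proof
  let ?G = "ec_group a b UNIV"
  interpret G: comm_group ?G by (rule comm_group_ec_group)
  let ?R = "Affine Rx Ry"
  assume R: "?R [^]\<^bsub>?G\<^esub> n = Infinity"
  \<comment> \<open>The conjugate of Q lies on the curve because the hypotheses on \<open>s\<close>
    hold for \<open>- s\<close> as well.\<close>
  have on: "?R \<in> carrier ?G"
    unfolding Q_minus_conjugate[symmetric] ec_group_sel
    by (intro ec_add_on ec_opp_on[THEN iffD2] Q_on nagao_curve.Q_on) (simp add: nagao_curve_def s u)
  obtain x y c where T: "ec_add a ?R (ec_add a ?R ?R) = Affine x y"
    and v: "val0 ((w\<^sup>2)\<^sup>2 * x) (1 / c\<^sup>2)" "val0 ((w\<^sup>2) ^ 3 * y) (1 / c ^ 3)" "c \<noteq> 0"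
    by (rule triple_R)
  \<comment> \<open>The index is \<open>n - 1\<close> because the multiples are counted by
    \<open>Suc n\<close>, starting at the point itself.\<close>
  obtain x' y' where "Affine x y [^]\<^bsub>?G\<^esub> n = Affine x' y'"
    using ec_multiple_at_cusp[OF v(1,2) val0_R(4) v(3), of b UNIV "n - 1"] assms by auto
  moreover have "Affine x y [^]\<^bsub>?G\<^esub> n = Infinity"
  proof -
    have "(p \<otimes>\<^bsub>?G\<^esub> q) [^]\<^bsub>?G\<^esub> n = p [^]\<^bsub>?G\<^esub> n \<otimes>\<^bsub>?G\<^esub> q [^]\<^bsub>?G\<^esub> n"
      if "p \<in> carrier ?G" "q \<in> carrier ?G" for p q
      by (rule G.pow_mult_distrib[OF G.m_comm[OF that] that])
    then have "(?R \<otimes>\<^bsub>?G\<^esub> (?R \<otimes>\<^bsub>?G\<^esub> ?R)) [^]\<^bsub>?G\<^esub> n = Infinity"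
      using on G.m_closed[OF on on] R by (simp only: ec_group_sel(1) ec_add.simps(1))
    then show ?thesis by (simp only: ec_group_sel(1) T)
  qed
  ultimately show False by simp
qed

end

text \<open>Powers depend only on the law and the neutral element, which are the same for all fields
  of definition.\<close>

lemma ec_group_pow_eq:
  "P [^]\<^bsub>ec_group a b L\<^esub> (n::nat) = P [^]\<^bsub>ec_group a b K\<^esub> n"
  by (simp add: nat_pow_def ec_group_def)

theorem theorem1:
  fixes z s t u a b :: "'a::field_char_0" and K L :: "'a set" and Q :: "'a ec_point"
  assumes "\<not> algebraic z"
    and "s\<^sup>2 = - 3"
    and "t = (23550 - z\<^sup>2) / (2 * z)"
    and "u = t\<^sup>2"
    and "a = nagao_a u" and "b = nagao_b u"
    and "K = rat_adjoin {z}" and "L = rat_adjoin {s, z}"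
    and "Q = Affine (Q_x s u) (Q_y s u)"
  shows "elliptic_curve K a b \<and>
         Q \<in> carrier (ec_group a b L) \<and>
         (\<forall>n::nat. n \<ge> 1 \<longrightarrow> Q [^]\<^bsub>ec_group a b L\<^esub> n \<notin> carrier (ec_group a b K)) \<and>
         (\<forall>S. card S = 13 \<and> int_independent (ec_group a b K) S \<longrightarrow>
            ab_rank (subgroup_generated (ec_group a b L) (insert Q S)) = 14)"
proof -
  have z: "z \<noteq> 0" "23550 - z\<^sup>2 \<noteq> 0"
  proof -
    show "z \<noteq> 0" using assms(1) by auto
    have "algebraic z" if "23550 - z\<^sup>2 = 0"
      by (rule algebraicI'[of "[:- 23550, 0, 1:]"])
        (use that in \<open>auto simp: power2_eq_square coeff_pCons split: nat.splits\<close>)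
    then show "23550 - z\<^sup>2 \<noteq> 0" using assms(1) by auto
  qed
  have "1 / u = 4 * z\<^sup>2 / (23550 - z\<^sup>2)\<^sup>2"
    using z by (simp add: assms(3,4) power_divide power_mult_distrib)
  then have u: "\<not> algebraic (1 / u)"
    using not_algebraic_inverse_square[OF assms(1) _ z(2)] by blast
  interpret nagao_curve s u
    rewrites "nagao_a u \<equiv> a" and "nagao_b u \<equiv> b"
    by unfold_locales (use assms u in auto)
  have K: "subfield_set K" and L: "subfield_set L"
    unfolding assms(7,8) by (rule subfield_set_rat_adjoin)+
  have "z \<in> K" "z \<in> L" "s \<in> L" by (auto simp: assms(7,8) rat_adjoin_incl)
  have KL: "K \<subseteq> L"
    unfolding assms(7) by (rule rat_adjoin_least[OF L]) (simp add: \<open>z \<in> L\<close>)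
  have sK: "s \<notin> K" unfolding assms(7) by (rule sqrt_notin_rat_adjoin[OF assms(1,2)])
  have uK: "u \<in> K" unfolding assms(3,4) using \<open>z \<in> K\<close> by (intro subfield_setD[OF K])
  have aK: "a \<in> K"
    unfolding assms(5) nagao_a_def using uK by (intro subfield_setD[OF K])
  have bK: "b \<in> K"
    unfolding assms(6) nagao_b_def using uK by (intro subfield_setD[OF K])
  have aL: "a \<in> L" and uL: "u \<in> L" using aK uK KL by auto

  let ?G = "ec_group a b UNIV"
  interpret G: comm_group ?G by (rule comm_group_ec_group)
  define Q' where "Q' = Affine (Q_x (- s) u) (Q_y (- s) u)"
  have Q_on: "Q \<in> carrier ?G" using Q_on by (simp add: assms(9))
  have Q'_on: "Q' \<in> carrier ?G"
    using nagao_curve.Q_on[of "- s" u] s u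
    by (auto simp: nagao_curve_def Q'_def assms(5,6) simp del: Affine_on)
  have Q_L: "Q \<in> carrier (ec_group a b L)"
    using Q_on \<open>s \<in> L\<close> uL unfolding assms(9) Affine_in_ec_group ec_group_sel Q_x_def Q_y_def
    by (intro conjI subfield_setD[OF L])
  note sub_K = subgroup_ec_group[OF K aK] and sub_L = subgroup_ec_group[OF L aL]

  have multiples: "Q [^]\<^bsub>?G\<^esub> n \<notin> carrier (ec_group a b K)" if "n \<ge> 1" for n :: nat
  proof
    assume nQ: "Q [^]\<^bsub>?G\<^esub> n \<in> carrier (ec_group a b K)"
    have num: "conjugate K s (numeral k) (numeral k)" for k
      by (intro conjugate_const[OF K assms(2) sK] subfield_setD[OF K])
    note intros = conjugate_add[OF K assms(2) sK] conjugate_diff[OF K assms(2) sK]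
      conjugate_mult[OF K assms(2) sK] num conjugate_s[OF K assms(2) sK]
      conjugate_const[OF K assms(2) sK uK]
    have "rel_ec_point (conjugate K s) Q Q'"
      unfolding assms(9) Q'_def Q_x_def Q_y_def power2_eq_square
      by (simp only: ec_point.rel_inject diff_conv_add_uminus[symmetric]) (intro conjI intros)
    then have "rel_ec_point (conjugate K s) (Q [^]\<^bsub>?G\<^esub> n) (Q' [^]\<^bsub>?G\<^esub> n)"
      by (rule conjugate_ec_group_pow[OF K assms(2) sK aK])
    then have eq: "Q [^]\<^bsub>?G\<^esub> n = Q' [^]\<^bsub>?G\<^esub> n"
      using nQ conjugate_in[OF K assms(2) sK]
      by (cases "Q [^]\<^bsub>?G\<^esub> n"; cases "Q' [^]\<^bsub>?G\<^esub> n") (auto simp: Affine_in_ec_group)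
    have "(Q \<otimes>\<^bsub>?G\<^esub> inv\<^bsub>?G\<^esub> Q') [^]\<^bsub>?G\<^esub> n = Q [^]\<^bsub>?G\<^esub> n \<otimes>\<^bsub>?G\<^esub> inv\<^bsub>?G\<^esub> (Q' [^]\<^bsub>?G\<^esub> n)"
      using Q_on Q'_on G.m_comm[of Q "inv\<^bsub>?G\<^esub> Q'"]
      by (subst G.pow_mult_distrib) (simp_all only: G.inv_closed G.nat_pow_inv)
    also have "\<dots> = Infinity" unfolding eq using Q'_on G.r_inv[of "Q' [^]\<^bsub>?G\<^esub> n"] G.nat_pow_closed by simp
    finally show False
      using R_nontorsion[OF that] Q_minus_conjugate inv_ec_group[of Q'] Q'_on
      by (simp add: Q'_def assms(9) del: ec_add.simps Affine_on ec_opp.simps)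
  qed

  have "ab_rank (subgroup_generated (ec_group a b L) (insert Q S)) = 14"
    if S: "card S = 13" "int_independent (ec_group a b K) S" for S
  proof -
    \<comment> \<open>Independence is given in E(K) and wanted in E(L); the transfer passes through
      the group over the ambient field, which contains both.\<close>
    have S_K: "S \<subseteq> carrier (ec_group a b K)" and S_G: "int_independent ?G S"
      using S(2) G.int_independent_subgroup_iff[OF sub_K] ec_group_restrict[of a b K] by auto
    have "int_independent ?G (insert Q S)"
      by (rule G.int_independent_insert[OF sub_K S_G S_K Q_on multiples])
    moreover have "carrier (ec_group a b K) \<subseteq> carrier (ec_group a b L)"
      using KL by (auto simp: ec_group_def)
    then have "insert Q S \<subseteq> carrier (ec_group a b L)" using S_K Q_L by auto
    ultimately have ind: "int_independent (ec_group a b L) (insert Q S)"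
      using G.int_independent_subgroup_iff[OF sub_L] ec_group_restrict[of a b L] by metis
    have "group (ec_group a b L)"
      using G.subgroup_imp_group[OF sub_L] ec_group_restrict[of a b L] by metis
    then have L_group: "comm_group (ec_group a b L)"
      using carrier_ec_group_subset[of a b L]
      by (intro group.group_comm_groupI) (auto intro!: ec_add_commute[of _ a b] simp del: ec_add.simps)
    have "finite S" using S(1) by (intro card_ge_0_finite) simp
    \<comment> \<open>The case n = 1 puts Q outside E(K), so the enlarged set has 14
      elements.\<close>
    moreover have "Q \<notin> S" using multiples[of 1] S_K Q_on by auto
    ultimately show ?thesis
      using comm_group.ab_rank_subgroup_generated[OF L_group _ ind] S(1)
      by (simp add: numeral_eq_enat)
  qed
  moreover have "elliptic_curve K a b"
    using aK bK nonsingular by (simp add: elliptic_curve_def)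
  ultimately show ?thesis
    using Q_L multiples ec_group_pow_eq[of a b L _ _ UNIV] by auto
qed

end
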